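(* For every prime $p\equiv 7\pmod{12}$ and for every $p\in\{37,61,73,109,157,181,229,277\}$, there exist a strictly $p$-cyclic $SQS(2\times p)$ and a perfect 2-D $(2\times p,4,2)$-OOC.
   Context: A strictly $v$-cyclic $SQS(u\times v)$ is a set of $4$-subsets (blocks) of $I_u\times Z_v$ ($I_u=\{0,\dots,u-1\}$) such that every $3$-subset is in exactly one block, invariant under $(i,x)\mapsto(i,x+1)$, and no block $B$ satisfies $B+\delta=B$ for nonzero $\delta\in Z_v$. A 2-D $(u\times v,4,2)$-OOC is a family of $u\times v$ $(0,1)$-matrices of weight $4$ such that for all codewords $A=(a_{ij}),B=(b_{ij})$ and integers $r$ with $A\ne B$ or $r\not\equiv0\pmod v$, $\sum_{i,j}a_{ij}b_{i,j+r}\le2$ (columns mod $v$); it is perfect if it has $u(uv-1)(uv-2)/24$ codewords. *)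

theory Defs
  imports "HOL-Computational_Algebra.Primes"
begin

text \<open>Point set I_u x Z_v, with Z_v represented by {0..<v}.\<close>
definition pts :: "nat \<Rightarrow> nat \<Rightarrow> (nat \<times> nat) set" where
  "pts u v = {0..<u} \<times> {0..<v}"

definition shiftv :: "nat \<Rightarrow> nat \<Rightarrow> (nat \<times> nat) set \<Rightarrow> (nat \<times> nat) set" where
  "shiftv v d B = (\<lambda>(i, x). (i, (x + d) mod v)) ` B"

definition SQS :: "nat \<Rightarrow> nat \<Rightarrow> (nat \<times> nat) set set \<Rightarrow> bool" where
  "SQS u v S \<longleftrightarrow>
     (\<forall>B\<in>S. B \<subseteq> pts u v \<and> card B = 4) \<and>
     (\<forall>T. T \<subseteq> pts u v \<and> card T = 3 \<longrightarrow> (\<exists>!B. B \<in> S \<and> T \<subseteq> B))"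

definition strictly_cyclic_SQS :: "nat \<Rightarrow> nat \<Rightarrow> (nat \<times> nat) set set \<Rightarrow> bool" where
  "strictly_cyclic_SQS u v S \<longleftrightarrow>
     SQS u v S \<and>
     (\<forall>B\<in>S. shiftv v 1 B \<in> S) \<and>
     (\<forall>B\<in>S. \<forall>d. 0 < d \<and> d < v \<longrightarrow> shiftv v d B \<noteq> B)"

text \<open>A u x v (0,1)-matrix is represented by the set of positions (i,j) of its 1-entries.
  The correlation sum_{i,j} a_ij b_{i,j+r} (columns mod v) is the number of
  1-positions (i,j) of A such that (i,(j+r) mod v) is a 1-position of B.\<close>
definition corr :: "nat \<Rightarrow> (nat \<times> nat) set \<Rightarrow> (nat \<times> nat) set \<Rightarrow> int \<Rightarrow> nat" where
  "corr v A B r = card {(i, j). (i, j) \<in> A \<and> (i, nat ((int j + r) mod int v)) \<in> B}"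

definition OOC2D :: "nat \<Rightarrow> nat \<Rightarrow> (nat \<times> nat) set set \<Rightarrow> bool" where
  "OOC2D u v C \<longleftrightarrow>
     (\<forall>A\<in>C. A \<subseteq> pts u v \<and> card A = 4) \<and>
     (\<forall>A\<in>C. \<forall>B\<in>C. \<forall>r::int. (A \<noteq> B \<or> r mod int v \<noteq> 0) \<longrightarrow> corr v A B r \<le> 2)"

definition perfect_OOC2D :: "nat \<Rightarrow> nat \<Rightarrow> (nat \<times> nat) set set \<Rightarrow> bool" where
  "perfect_OOC2D u v C \<longleftrightarrow>
     OOC2D u v C \<and> card C = u * (u * v - 1) * (u * v - 2) div 24"

end

theory Submission
  imports Defs "HOL-Number_Theory.Number_Theory"
begin

text \<open>
  A totally symmetric quaternary relation in which any three distinct points have exactly one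
  completion is a Steiner quadruple system.  On two copies of \<open>Z\<^sub>p\<close>, the second one carrying the
  negatives of the blocks of the first, such a relation is given by three relations on \<open>Z\<^sub>p\<close>:
  \<open>B40\<close> for blocks inside one row, \<open>B31\<close> for blocks \<open>{x, y, z}\<^sub>0 {w}\<^sub>1\<close>, and \<open>B22\<close> for blocks
  \<open>{x, y}\<^sub>0 {c, d}\<^sub>1\<close>.

  For \<open>p = 7 (mod 12)\<close> let \<open>e\<close> be a primitive sixth root of unity.  The quadruples of
  \<open>Z\<^sub>p \<union> {\<infinity>}\<close> with cross ratio \<open>e\<close>, oriented by the quadratic character (\<open>- 1\<close> is a
  nonresidue), form a \<open>PSL(2,p)\<close>-invariant quadruple system.  Its blocks avoiding \<open>\<infinity>\<close> are \<open>B40\<close>.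
  Its blocks through \<open>\<infinity>\<close> are the equilateral triangles \<open>{x, y, z}\<close>; in \<open>B31\<close> they are completed by
  the centre \<open>w\<close> in the other row.  The remaining points \<open>w + i (y - x)\<close> of that row, \<open>0 < i < p\<close>,
  are paired consecutively in \<open>B22\<close>.

  For the eight exceptional primes, \<open>B22\<close> consists of the harmonic quadruples, \<open>B31\<close> of the
  arithmetic progressions \<open>{x - t, x, x + t}\<^sub>0 {x}\<^sub>1\<close>, and \<open>B40\<close> of the affine images of the
  quadruple \<open>{0, 1, e, (1 + e) / 3}\<close> and of quadruples \<open>{0, 1, a, 1 - a}\<close>.  Normalizing two points
  of a triple to 0 and 1, it remains to check that the ratios of the base blocks run exactly once
  through all third points for which the triple is not an arithmetic progression.

  Since \<open>p > 4\<close>, no block is fixed by a translation, and representatives of the translation orbits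
  form a perfect code.
\<close>

section \<open>Quadruple systems from totally symmetric relations\<close>

locale totally_symmetric =
  fixes R :: "'a \<Rightarrow> 'a \<Rightarrow> 'a \<Rightarrow> 'a \<Rightarrow> bool"
  assumes swap12: "R a b c d \<Longrightarrow> R b a c d"
    and swap23: "R a b c d \<Longrightarrow> R a c b d"
    and swap34: "R a b c d \<Longrightarrow> R a b d c"
begin

lemma move_to_first:
  assumes "R a b c d" "x \<in> {a, b, c, d}"
  shows "\<exists>b' c' d'. R x b' c' d' \<and> {x, b', c', d'} = {a, b, c, d}"
proof -
  have "R b a c d" "R c a b d" "R d a b c"
    using assms(1) swap12 swap23 swap34 by blast+
  then show ?thesis
    using assms by (elim insertE emptyE) (use insert_commute in fast)+
qed

lemma move_to_second:
  assumes "R a b c d" "x \<in> {b, c, d}"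
  shows "\<exists>c' d'. R a x c' d' \<and> {a, x, c', d'} = {a, b, c, d}"
proof -
  have "R a c b d" "R a d b c"
    using assms(1) swap23 swap34 by blast+
  then show ?thesis
    using assms by (elim insertE emptyE) (use insert_commute in fast)+
qed

lemma permute:
  assumes "R a b c d" "{a, b, c, d} = {x, y, z, w}" "distinct [x, y, z, w]"
  shows "R x y z w"
proof -
  obtain b1 c1 d1 where first: "R x b1 c1 d1" "{x, b1, c1, d1} = {x, y, z, w}"
    using move_to_first[OF assms(1), of x] assms(2) by auto
  have "y \<in> {x, b1, c1, d1}" "x \<noteq> y"
    unfolding first(2) using assms(3) by simp_all
  then have "y \<in> {b1, c1, d1}"
    by simp
  from move_to_second[OF first(1) this]
  obtain c2 d2 where second: "R x y c2 d2" "{x, y, c2, d2} = {x, y, z, w}"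
    unfolding first(2) by blast
  have "z \<in> {x, y, c2, d2}" "w \<in> {x, y, c2, d2}"
    unfolding second(2) by simp_all
  then have "c2 = z \<and> d2 = w \<or> c2 = w \<and> d2 = z"
    using assms(3) by auto
  then show ?thesis
    using second(1) swap34 by blast
qed

lemma completion_of_subtriple:
  assumes "R a b c d" "distinct [a, b, c, d]" "{x, y, z} \<subseteq> {a, b, c, d}" "distinct [x, y, z]"
  shows "\<exists>w. R x y z w \<and> {a, b, c, d} = {x, y, z, w}"
proof -
  have "card ({a, b, c, d} - {x, y, z}) = 1"
    using assms(2-4) by (subst card_Diff_subset) auto
  then obtain w where "{a, b, c, d} - {x, y, z} = {w}"
    by (auto simp: card_1_singleton_iff)
  then have "w \<notin> {x, y, z}" "{a, b, c, d} = {x, y, z, w}"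
    using assms(3) by blast+
  moreover from this have "R x y z w"
    using assms(4) by (intro permute[OF assms(1)]) auto
  ultimately show ?thesis
    by blast
qed

lemma respects_all:
  assumes "\<And>a b c d d'. R a b c d \<Longrightarrow> E d d' \<Longrightarrow> R a b c d'"
    and "R a b c d" "E a a'" "E b b'" "E c c'" "E d d'"
  shows "R a' b' c' d'"
proof -
  have "R a b c d'"
    by (rule assms(1)[OF assms(2,6)])
  then have "R a b c' d'"
    using assms(1,5) swap34 by blast
  then have "R a b' c' d'"
    using assms(1,4) swap23 swap34 by blast
  then show ?thesis
    using assms(1,3) swap12 swap23 swap34 by blast
qed

lemma pairwise_of_first_two:
  assumes "\<And>a b c d. R a b c d \<Longrightarrow> Q a b" "R a b c d"
  shows "Q a b" "Q a c" "Q a d" "Q b c" "Q b d" "Q c d"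
proof -
  have "R c d a b" "R b d a c" "R b c a d" "R a d b c" "R a c b d"
    using assms(2) swap12 swap23 swap34 by blast+
  then show "Q a b" "Q a c" "Q a d" "Q b c" "Q b d" "Q c d"
    using assms by blast+
qed

end

definition quadruples_on :: "'a set \<Rightarrow> ('a \<Rightarrow> 'a \<Rightarrow> 'a \<Rightarrow> 'a \<Rightarrow> bool) \<Rightarrow> 'a set set" where
  "quadruples_on V R = {{a, b, c, d} | a b c d. {a, b, c, d} \<subseteq> V \<and> R a b c d}"

lemma (in totally_symmetric) unique_quadruple_on:
  assumes distinct: "\<And>a b c d. R a b c d \<Longrightarrow> distinct [a, b, c, d]"
    and triple: "distinct [x, y, z]" "{x, y, z} \<subseteq> V"
    and completion: "w \<in> V" "R x y z w"
    and unique: "\<And>w'. w' \<in> V \<Longrightarrow> R x y z w' \<Longrightarrow> w' = w"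
  shows "\<exists>!B. B \<in> quadruples_on V R \<and> {x, y, z} \<subseteq> B"
proof (rule ex1I)
  show "{x, y, z, w} \<in> quadruples_on V R \<and> {x, y, z} \<subseteq> {x, y, z, w}"
    using triple(2) completion unfolding quadruples_on_def by blast
next
  fix B assume "B \<in> quadruples_on V R \<and> {x, y, z} \<subseteq> B"
  then obtain a b c d where block: "B = {a, b, c, d}" "B \<subseteq> V" "R a b c d" "{x, y, z} \<subseteq> {a, b, c, d}"
    unfolding quadruples_on_def by blast
  then obtain w' where "R x y z w'" "B = {x, y, z, w'}"
    using completion_of_subtriple[OF block(3) distinct[OF block(3)] block(4) triple(1)] by auto
  then show "B = {x, y, z, w}"
    using unique[of w'] block(2) by simp
qed

lemma SQS_of_totally_symmetric:
  assumes "totally_symmetric R"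
    and irrefl: "\<And>a b c d. R a b c d \<Longrightarrow> a \<noteq> b"
    and completion: "\<And>a b c. {a, b, c} \<subseteq> pts u v \<Longrightarrow> distinct [a, b, c] \<Longrightarrow> \<exists>d\<in>pts u v. R a b c d"
    and unique: "\<And>a b c d d'. R a b c d \<Longrightarrow> R a b c d' \<Longrightarrow> {d, d'} \<subseteq> pts u v \<Longrightarrow> d = d'"
  shows "SQS u v (quadruples_on (pts u v) R)"
  unfolding SQS_def
proof (intro conjI ballI allI impI)
  interpret totally_symmetric R by fact
  have distinct: "distinct [a, b, c, d]" if "R a b c d" for a b c d
    using pairwise_of_first_two[of "(\<noteq>)", OF irrefl that] by auto
  show "B \<subseteq> pts u v" "card B = 4" if "B \<in> quadruples_on (pts u v) R" for B
    using that distinct unfolding quadruples_on_def by fastforce+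
  fix T assume "T \<subseteq> pts u v \<and> card T = 3"
  then obtain x y z where triple: "T = {x, y, z}" "distinct [x, y, z]" "{x, y, z} \<subseteq> pts u v"
    by (auto simp: card_3_iff)
  then obtain w where fourth: "w \<in> pts u v" "R x y z w"
    using completion by blast
  moreover have "w' = w" if "w' \<in> pts u v" "R x y z w'" for w'
    using unique[OF that(2) fourth(2)] that(1) fourth(1) by simp
  ultimately show "\<exists>!B. B \<in> quadruples_on (pts u v) R \<and> T \<subseteq> B"
    unfolding triple(1) using distinct triple(2,3) by (intro unique_quadruple_on)
qed

section \<open>Translations\<close>

lemma shiftv_shiftv: "shiftv v d (shiftv v e B) = shiftv v (e + d) B"
  unfolding shiftv_def image_image by (rule image_cong) (auto simp: mod_simps add.assoc)

lemma shiftv_mod: "shiftv v (d mod v) B = shiftv v d B"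
  unfolding shiftv_def by (rule image_cong) (auto simp: mod_simps)

lemma shiftv_0: "B \<subseteq> pts u v \<Longrightarrow> shiftv v 0 B = B"
  unfolding shiftv_def pts_def by (force simp: image_iff)

lemma shiftv_uminus:
  assumes "B \<subseteq> pts u v" "0 < v"
  shows "shiftv v (v - d mod v) (shiftv v d B) = B"
proof -
  have "(d + (v - d mod v)) mod v = (d mod v + (v - d mod v)) mod v"
    by (simp add: mod_simps)
  also have "\<dots> = 0"
    using assms(2) by (simp add: less_imp_le)
  finally have "shiftv v (d + (v - d mod v)) B = shiftv v 0 B"
    by (metis shiftv_mod)
  then show ?thesis
    using shiftv_0[OF assms(1)] by (simp add: shiftv_shiftv)
qed

lemma inj_on_shift: "inj_on (\<lambda>(i :: nat, x). (i, (x + d) mod v)) (pts u v)"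
proof (rule inj_onI, clarsimp)
  fix i x y :: nat
  assume points: "(i, x) \<in> pts u v" "(i, y) \<in> pts u v" and "(x + d) mod v = (y + d) mod v"
  then have "[x = y] (mod v)"
    by (simp add: cong_add_rcancel_nat flip: cong_def)
  then show "x = y"
    using points by (simp add: pts_def cong_less_modulus_unique_nat)
qed

lemma shiftv_fixed_imp_card_ge:
  assumes "prime p" "0 < d" "d < p" "B \<noteq> {}" "finite B" "B \<subseteq> pts u p" "shiftv p d B = B"
  shows "p \<le> card B"
proof -
  obtain i x where point: "(i, x) \<in> B"
    using assms(4) by auto
  have orbit: "(i, (x + k * d) mod p) \<in> B" for k
  proof (induction k)
    case 0
    then show ?case
      using point assms(6) by (auto simp: pts_def)
  next
    case (Suc k)
    then have "(i, ((x + k * d) mod p + d) mod p) \<in> shiftv p d B"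
      unfolding shiftv_def by force
    then show ?case
      using assms(7) by (simp add: mod_simps algebra_simps)
  qed
  have "inj_on (\<lambda>k. (i, (x + k * d) mod p)) {..<p}"
  proof (rule inj_onI)
    fix k l
    assume bounds: "k \<in> {..<p}" "l \<in> {..<p}"
      and eq: "(i, (x + k * d) mod p) = (i, (x + l * d) mod p)"
    have "coprime d p"
      using assms(1-3) by (metis coprime_commute nat_dvd_not_less prime_imp_coprime)
    moreover have "[x + k * d = x + l * d] (mod p)"
      using eq by (simp add: cong_def)
    ultimately have "[k = l] (mod p)"
      by (metis cong_add_lcancel_nat cong_mult_rcancel_nat)
    then show "k = l"
      using bounds by (simp add: cong_less_modulus_unique_nat)
  qed
  then have "card {..<p} \<le> card B"
    using card_inj_on_le[of _ "{..<p}" B] orbit assms(5) by blast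
  then show ?thesis
    by simp
qed

definition orbit :: "nat \<Rightarrow> (nat \<times> nat) set \<Rightarrow> (nat \<times> nat) set set" where
  "orbit v B = (\<lambda>d. shiftv v d B) ` {..<v}"

lemma shiftv_in_orbit: "0 < v \<Longrightarrow> shiftv v d B \<in> orbit v B"
  unfolding orbit_def using shiftv_mod[of v d B] by (metis imageI lessThan_iff mod_less_divisor)

lemma orbit_shiftv:
  assumes "B \<subseteq> pts u v" "0 < v"
  shows "orbit v (shiftv v d B) = orbit v B"
proof -
  have subset: "orbit v (shiftv v d A) \<subseteq> orbit v A" for A d
    using shiftv_in_orbit[OF assms(2)] by (auto simp: orbit_def shiftv_shiftv)
  show ?thesis
    using subset[of d B] subset[of "v - d mod v" "shiftv v d B"]
    unfolding shiftv_uminus[OF assms] by (rule equalityI)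
qed

section \<open>Codes from strictly cyclic quadruple systems\<close>

lemma six_times_choose_three: "6 * (n choose 3) = n * (n - 1) * (n - 2)"
proof -
  have "3 * (n choose 3) = n * ((n - 1) choose 2)"
    using times_binomial_minus1_eq[of 3 n] by simp
  moreover have "2 * ((n - 1) choose 2) = (n - 1) * (n - 2)"
    using times_binomial_minus1_eq[of 2 "n - 1"] by (simp add: numeral_2_eq_2)
  moreover have "6 * (n choose 3) = 3 * (n choose 3) * 2"
    by simp
  ultimately show ?thesis
    by (simp add: ac_simps)
qed

locale quadruple_system =
  fixes u v :: nat and S :: "(nat \<times> nat) set set"
  assumes SQS: "SQS u v S"
begin

lemma block_subset: "B \<in> S \<Longrightarrow> B \<subseteq> pts u v"
  and card_block: "B \<in> S \<Longrightarrow> card B = 4"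
  and unique_block: "T \<subseteq> pts u v \<Longrightarrow> card T = 3 \<Longrightarrow> \<exists>!B. B \<in> S \<and> T \<subseteq> B"
  using SQS unfolding SQS_def by auto

lemma finite_block: "B \<in> S \<Longrightarrow> finite B"
  using card_block by (intro card_ge_0_finite) simp

lemma finite_blocks: "finite S"
proof (rule finite_subset)
  show "S \<subseteq> Pow (pts u v)"
    using block_subset by blast
qed (simp add: pts_def)

lemma blocks_eqI:
  assumes "A \<in> S" "B \<in> S" "3 \<le> card (A \<inter> B)"
  shows "A = B"
proof -
  obtain T where "T \<subseteq> A \<inter> B" "card T = 3"
    using obtain_subset_with_card_n[OF assms(3)] by metis
  then show ?thesis
    using unique_block[of T] block_subset assms(1,2) by blast
qed

lemma four_times_card_blocks: "4 * card S = (u * v) choose 3"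
proof -
  let ?triples = "{T. T \<subseteq> pts u v \<and> card T = 3}"
  have "finite ?triples"
    by (rule finite_subset[of _ "Pow (pts u v)"]) (auto simp: pts_def)
  moreover have "card {B \<in> S. T \<subseteq> B} = 1" if "T \<in> ?triples" for T
    using that unique_block[of T] by (auto simp: card_1_singleton_iff Ex1_def)
  ultimately have "(\<Sum>B\<in>S. card {T \<in> ?triples. T \<subseteq> B}) = card ?triples"
    using sum_multicount[of S ?triples "\<lambda>B T. T \<subseteq> B" 1] finite_blocks by simp
  moreover have "card {T \<in> ?triples. T \<subseteq> B} = 4" if "B \<in> S" for B
  proof -
    have "{T \<in> ?triples. T \<subseteq> B} = {T. T \<subseteq> B \<and> card T = 3}"
      using block_subset[OF that] by auto
    then show ?thesis
      using n_subsets[OF finite_block[OF that], of 3] card_block[OF that]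
      by (simp add: eval_nat_numeral)
  qed
  moreover have "card ?triples = (u * v) choose 3"
    using n_subsets[of "pts u v" 3] by (simp add: pts_def)
  ultimately show ?thesis
    by simp
qed

end

locale strictly_cyclic_quadruple_system =
  fixes u v :: nat and S :: "(nat \<times> nat) set set"
  assumes strictly_cyclic: "strictly_cyclic_SQS u v S" and v_pos: "0 < v"

sublocale strictly_cyclic_quadruple_system \<subseteq> quadruple_system
  using strictly_cyclic unfolding strictly_cyclic_SQS_def by unfold_locales simp

context strictly_cyclic_quadruple_system
begin

lemma no_fixed_block: "B \<in> S \<Longrightarrow> 0 < d \<Longrightarrow> d < v \<Longrightarrow> shiftv v d B \<noteq> B"
  using strictly_cyclic unfolding strictly_cyclic_SQS_def by blast

lemma shiftv_block:
  assumes "B \<in> S"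
  shows "shiftv v d B \<in> S"
proof (induction d)
  case 0
  then show ?case
    using assms shiftv_0[OF block_subset] by simp
next
  case (Suc d)
  then have "shiftv v 1 (shiftv v d B) \<in> S"
    using strictly_cyclic unfolding strictly_cyclic_SQS_def by blast
  then show ?case
    by (simp add: shiftv_shiftv)
qed

lemma card_orbit:
  assumes "B \<in> S"
  shows "card (orbit v B) = v"
proof -
  have "d = e" if "shiftv v d B = shiftv v e B" "d \<le> e" "e < v" for d e
  proof -
    have "shiftv v (v - d) (shiftv v d B) = B"
      using shiftv_uminus[OF block_subset[OF assms] v_pos, of d] that by simp
    moreover have "shiftv v (v - d) (shiftv v e B) = shiftv v (e - d) B"
    proof -
      have "e + (v - d) = e - d + v"
        using that(2,3) by simp
      then show ?thesis
        using shiftv_mod[of v "e - d + v" B] shiftv_mod[of v "e - d" B]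
        by (simp only: shiftv_shiftv mod_add_self2)
    qed
    ultimately show ?thesis
      using no_fixed_block[OF assms, of "e - d"] that by (cases "d = e") simp_all
  qed
  then have "inj_on (\<lambda>d. shiftv v d B) {..<v}"
    by (intro linorder_inj_onI) (auto dest: less_imp_le)
  then show ?thesis
    unfolding orbit_def by (simp add: card_image)
qed

lemma card_orbits: "v * card (orbit v ` S) = card S"
proof -
  have Union: "\<Union> (orbit v ` S) = S"
  proof (intro equalityI subsetI)
    fix B assume "B \<in> \<Union> (orbit v ` S)"
    then show "B \<in> S"
      unfolding orbit_def using shiftv_block by auto
  next
    fix B assume "B \<in> S"
    then show "B \<in> \<Union> (orbit v ` S)"
      using shiftv_in_orbit[OF v_pos, of 0 B] shiftv_0[OF block_subset] by auto
  qed
  have orbit_eq: "orbit v B = orbit v A" if "A \<in> S" "B \<in> orbit v A" for A B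
    using that(2) orbit_shiftv[OF block_subset[OF that(1)] v_pos] unfolding orbit_def by blast
  have "v * card (orbit v ` S) = card (\<Union> (orbit v ` S))"
  proof (rule card_partition)
    show "c1 \<inter> c2 = {}" if "c1 \<in> orbit v ` S" "c2 \<in> orbit v ` S" "c1 \<noteq> c2" for c1 c2
      using that orbit_eq by blast
  qed (use finite_blocks card_orbit Union in auto)
  then show ?thesis
    unfolding Union .
qed

lemma corr_eq_card_Int:
  assumes "A \<subseteq> pts u v"
  shows "corr v A B r = card (shiftv v (nat (r mod int v)) A \<inter> B)"
proof -
  define f where "f = (\<lambda>(i :: nat, j). (i, (j + nat (r mod int v)) mod v))"
  have "(int j + r) mod int v = int ((j + nat (r mod int v)) mod v)" for j
    using v_pos by (simp add: zmod_int mod_simps)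
  then have "{(i, j). (i, j) \<in> A \<and> (i, nat ((int j + r) mod int v)) \<in> B} = {a \<in> A. f a \<in> B}"
    unfolding f_def by auto
  moreover have "shiftv v (nat (r mod int v)) A \<inter> B = f ` {a \<in> A. f a \<in> B}"
    unfolding shiftv_def f_def by blast
  moreover have "inj_on f {a \<in> A. f a \<in> B}"
    unfolding f_def using assms by (intro inj_on_subset[OF inj_on_shift]) auto
  ultimately show ?thesis
    unfolding corr_def by (simp add: card_image)
qed

lemma OOC2D_orbit_representatives:
  assumes "C \<subseteq> S" "inj_on (orbit v) C"
  shows "OOC2D u v C"
proof -
  have "corr v A B r \<le> 2" if "A \<in> C" "B \<in> C" "A \<noteq> B \<or> r mod int v \<noteq> 0" for A B r
  proof (rule ccontr)
    define d where "d = nat (r mod int v)"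
    have blocks: "A \<in> S" "B \<in> S"
      using that assms(1) by auto
    assume "\<not> corr v A B r \<le> 2"
    then have shift: "shiftv v d A = B"
      using corr_eq_card_Int[OF block_subset[OF blocks(1)], of B r] blocks
      by (intro blocks_eqI shiftv_block) (simp_all add: d_def)
    then have "orbit v A = orbit v B"
      using orbit_shiftv[OF block_subset[OF blocks(1)] v_pos] by metis
    then have "A = B"
      using assms(2) that(1,2) by (simp add: inj_on_eq_iff)
    moreover have "0 \<le> r mod int v" "r mod int v < int v"
      using v_pos by simp_all
    ultimately have "0 < d" "d < v"
      using that(3) by (simp_all add: d_def nat_less_iff)
    then show False
      using no_fixed_block[OF blocks(1)] shift \<open>A = B\<close> by blast
  qed
  then show ?thesis
    unfolding OOC2D_def using assms(1) block_subset card_block by blast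
qed

lemma perfect_OOC2D_exists: "\<exists>C. perfect_OOC2D u v C"
proof -
  obtain C where representatives: "C \<subseteq> S" "inj_on (orbit v) C" "orbit v ` S = orbit v ` C"
    using subset_image_inj[of "orbit v ` S" "orbit v" S] by auto
  then have "v * card C = card S"
    using card_orbits by (simp add: card_image)
  then have "v * (24 * card C) = 6 * ((u * v) choose 3)"
    using four_times_card_blocks by simp
  also have "\<dots> = v * (u * (u * v - 1) * (u * v - 2))"
    unfolding six_times_choose_three by simp
  finally have "card C = u * (u * v - 1) * (u * v - 2) div 24"
    using v_pos by simp
  then show ?thesis
    using OOC2D_orbit_representatives[OF representatives(1,2)] unfolding perfect_OOC2D_def by blast
qed

end

section \<open>Quadruples of integers modulo a prime\<close>

locale prime_modulus =
  fixes p :: nat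
  assumes prime_p: "prime p"
begin

abbreviation P :: int where "P \<equiv> int p"

lemma P_pos: "0 < P"
  using prime_p by (simp add: prime_gt_0_nat)

lemma P_dvd_mult_iff: "P dvd a * b \<longleftrightarrow> P dvd a \<or> P dvd b"
  using prime_p by (intro prime_dvd_mult_iff) simp

lemma exists_quotient:
  assumes "\<not> P dvd a"
  shows "\<exists>t. P dvd a * t - b"
proof -
  have "coprime a P"
    using assms prime_p prime_imp_coprime[of P a] by (simp add: coprime_commute)
  then obtain t where "[a * t = 1] (mod P)"
    using cong_solve_coprime_int by blast
  then have "P dvd a * (t * b) - b"
    unfolding cong_iff_dvd_diff by Groebner_Basis.algebra
  then show ?thesis ..
qed

abbreviation translate :: "int \<Rightarrow> 'r \<times> int \<Rightarrow> 'r \<times> int" where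
  "translate t \<equiv> apsnd (\<lambda>x. x + t)"

definition same_point :: "'r \<times> int \<Rightarrow> 'r \<times> int \<Rightarrow> bool" where
  "same_point a b \<longleftrightarrow> fst a = fst b \<and> P dvd snd a - snd b"

end

locale cyclic_quadruple_relation = prime_modulus p + totally_symmetric R
  for p :: nat and R :: "'r \<times> int \<Rightarrow> 'r \<times> int \<Rightarrow> 'r \<times> int \<Rightarrow> 'r \<times> int \<Rightarrow> bool" +
  fixes u :: nat and row :: "nat \<Rightarrow> 'r"
  assumes p_gt_4: "4 < p"
    and bij_row: "bij_betw row {..<u} UNIV"
    and R_same_point: "R a b c d \<Longrightarrow> same_point d d' \<Longrightarrow> R a b c d'"
    and R_irrefl: "R a b c d \<Longrightarrow> \<not> same_point a b"
    and R_completion: "\<not> same_point a b \<Longrightarrow> \<not> same_point a c \<Longrightarrow> \<not> same_point b c \<Longrightarrow>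
      \<exists>d. R a b c d"
    and R_unique: "R a b c d \<Longrightarrow> R a b c d' \<Longrightarrow> same_point d d'"
    and R_add: "R a b c d \<Longrightarrow>
      R (translate t a) (translate t b) (translate t c) (translate t d)"
begin

abbreviation to_int :: "nat \<times> nat \<Rightarrow> 'r \<times> int" where
  "to_int \<equiv> map_prod row int"

definition blocks :: "(nat \<times> nat) set set" where
  "blocks = quadruples_on (pts u p) (\<lambda>a b c d. R (to_int a) (to_int b) (to_int c) (to_int d))"

lemma same_point_imp_eq:
  assumes "a \<in> pts u p" "b \<in> pts u p" "same_point (to_int a) (to_int b)"
  shows "a = b"
proof -
  have "row (fst a) = row (fst b)" "[snd a = snd b] (mod p)"
    using assms(3) unfolding same_point_def by (simp_all add: cong_int_iff flip: cong_iff_dvd_diff)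
  moreover have "fst a < u" "fst b < u" "snd a < p" "snd b < p"
    using assms(1,2) by (auto simp: pts_def)
  ultimately show ?thesis
    using bij_betw_imp_inj_on[OF bij_row]
    by (simp add: cong_less_modulus_unique_nat prod_eq_iff inj_on_eq_iff)
qed

lemma exists_same_point: "\<exists>b\<in>pts u p. same_point a (to_int b)"
proof -
  obtain i where row_i: "i < u" "row i = fst a"
    using bij_betw_imp_surj_on[OF bij_row] by (metis UNIV_I imageE lessThan_iff)
  define b where "b = (i, nat (snd a mod P))"
  have "b \<in> pts u p" "same_point a (to_int b)"
    using row_i P_pos
    by (simp_all add: b_def pts_def nat_less_iff same_point_def flip: mod_eq_dvd_iff)
  then show ?thesis ..
qed

lemma SQS_blocks: "SQS u p blocks"
  unfolding blocks_def
proof (rule SQS_of_totally_symmetric)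
  show "totally_symmetric (\<lambda>a b c d. R (to_int a) (to_int b) (to_int c) (to_int d))"
    by unfold_locales (fact swap12 swap23 swap34)+
next
  show "a \<noteq> b" if "R (to_int a) (to_int b) (to_int c) (to_int d)" for a b c d
    using R_irrefl[OF that] by (auto simp: same_point_def)
next
  fix a b c
  assume triple: "{a, b, c} \<subseteq> pts u p" "distinct [a, b, c]"
  have "\<not> same_point (to_int a) (to_int b)" "\<not> same_point (to_int a) (to_int c)"
    "\<not> same_point (to_int b) (to_int c)"
    using triple by (simp; use same_point_imp_eq in blast)+
  then obtain d where completion: "R (to_int a) (to_int b) (to_int c) d"
    using R_completion by blast
  obtain d' where "d' \<in> pts u p" "same_point d (to_int d')"
    using exists_same_point by blast
  then show "\<exists>d'\<in>pts u p. R (to_int a) (to_int b) (to_int c) (to_int d')"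
    using R_same_point[OF completion] by blast
next
  show "d = d'" if "R (to_int a) (to_int b) (to_int c) (to_int d)"
    "R (to_int a) (to_int b) (to_int c) (to_int d')" "{d, d'} \<subseteq> pts u p" for a b c d d'
    using R_unique[OF that(1,2)] same_point_imp_eq that(3) by blast
qed

lemma shiftv_1_blocks:
  assumes "B \<in> blocks"
  shows "shiftv p 1 B \<in> blocks"
proof -
  obtain a b c d where block: "B = {a, b, c, d}" "B \<subseteq> pts u p"
      "R (to_int a) (to_int b) (to_int c) (to_int d)"
    using assms unfolding blocks_def quadruples_on_def by blast
  define s where "s = (\<lambda>(i :: nat, x). (i, (x + 1) mod p))"
  have s_eq: "same_point (translate 1 (to_int e)) (to_int (s e))" for e
    by (cases e) (simp add: same_point_def s_def zmod_int add.commute flip: mod_eq_dvd_iff)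
  have "R (to_int (s a)) (to_int (s b)) (to_int (s c)) (to_int (s d))"
    by (rule respects_all[where E = same_point, OF R_same_point R_add[OF block(3)]
          s_eq s_eq s_eq s_eq])
  moreover have "shiftv p 1 B = {s a, s b, s c, s d}"
    unfolding shiftv_def s_def block(1) by simp
  moreover have "s e \<in> pts u p" if "e \<in> pts u p" for e
    using that by (cases e) (simp add: pts_def s_def)
  ultimately show ?thesis
    using block(1,2) unfolding blocks_def quadruples_on_def by blast
qed

lemma strictly_cyclic_blocks: "strictly_cyclic_SQS u p blocks"
proof -
  interpret quadruple_system u p blocks
    by unfold_locales (fact SQS_blocks)
  have "shiftv p d B \<noteq> B" if "B \<in> blocks" "0 < d" "d < p" for B d
    using shiftv_fixed_imp_card_ge[OF prime_p that(2,3) _ finite_block block_subset, OF _ that(1,1)]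
      card_block[OF that(1)] p_gt_4 by fastforce
  then show ?thesis
    unfolding strictly_cyclic_SQS_def using SQS_blocks shiftv_1_blocks by blast
qed

end

section \<open>Two rows with opposite blocks\<close>

locale doubling = prime_modulus +
  fixes B40 B31 B22 :: "int \<Rightarrow> int \<Rightarrow> int \<Rightarrow> int \<Rightarrow> bool"
  assumes p_gt_4: "4 < p"
    and B40_swap: "B40 x y z w \<Longrightarrow> B40 y x z w" "B40 x y z w \<Longrightarrow> B40 x z y w"
      "B40 x y z w \<Longrightarrow> B40 x y w z"
    and B31_swap: "B31 x y z w \<Longrightarrow> B31 y x z w" "B31 x y z w \<Longrightarrow> B31 x z y w"
    and B22_swap: "B22 x y z w \<Longrightarrow> B22 y x z w" "B22 x y z w \<Longrightarrow> B22 x y w z"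
    and B22_opposite: "B22 x y z w \<Longrightarrow> B22 (- z) (- w) (- x) (- y)"
    and B40_add: "B40 x y z w \<Longrightarrow> B40 (x + t) (y + t) (z + t) (w + t)"
    and B31_add: "B31 x y z w \<Longrightarrow> B31 (x + t) (y + t) (z + t) (w + t)"
    and B22_add: "B22 x y z w \<Longrightarrow> B22 (x + t) (y + t) (z + t) (w + t)"
    and B40_cong: "B40 x y z w \<Longrightarrow> P dvd w - w' \<Longrightarrow> B40 x y z w'"
    and B31_cong: "B31 x y z w \<Longrightarrow> P dvd w - w' \<Longrightarrow> B31 x y z w'"
      "B31 x y z w \<Longrightarrow> P dvd z - z' \<Longrightarrow> B31 x y z' w"
    and B22_cong: "B22 x y z w \<Longrightarrow> P dvd w - w' \<Longrightarrow> B22 x y z w'"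
    and B40_irrefl: "B40 x y z w \<Longrightarrow> \<not> P dvd x - y"
    and B31_irrefl: "B31 x y z w \<Longrightarrow> \<not> P dvd x - y"
    and B22_irrefl: "B22 x y z w \<Longrightarrow> \<not> P dvd x - y"
    and B40_or_B31: "\<not> P dvd x - y \<Longrightarrow> \<not> P dvd x - z \<Longrightarrow> \<not> P dvd y - z \<Longrightarrow>
      (\<exists>w. B40 x y z w) \<or> (\<exists>w. B31 x y z w)"
    and B40_not_B31: "B40 x y z w \<Longrightarrow> \<not> B31 x y z w'"
    and B40_unique: "B40 x y z w \<Longrightarrow> B40 x y z w' \<Longrightarrow> P dvd w - w'"
    and B31_fourth_unique: "B31 x y z w \<Longrightarrow> B31 x y z w' \<Longrightarrow> P dvd w - w'"
    and B31_or_B22: "\<not> P dvd x - y \<Longrightarrow> (\<exists>z. B31 x y z w) \<or> (\<exists>z. B22 x y w z)"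
    and B22_not_B31: "B22 x y w z \<Longrightarrow> \<not> B31 x y z' w"
    and B22_unique: "B22 x y z w \<Longrightarrow> B22 x y z w' \<Longrightarrow> P dvd w - w'"
    and B31_third_unique: "B31 x y z w \<Longrightarrow> B31 x y z' w \<Longrightarrow> P dvd z - z'"
begin

definition opposite :: "bool \<times> int \<Rightarrow> bool \<times> int" where
  "opposite = map_prod Not uminus"

(* The rows 0 and 1 are labelled False and True. *)
fun block_at_row_False :: "int \<Rightarrow> bool \<times> int \<Rightarrow> bool \<times> int \<Rightarrow> bool \<times> int \<Rightarrow> bool" where
  "block_at_row_False x (False, y) (False, z) (False, w) = B40 x y z w"
| "block_at_row_False x (False, y) (False, z) (True, w) = B31 x y z w"
| "block_at_row_False x (False, y) (True, z) (False, w) = B31 x y w z"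
| "block_at_row_False x (True, y) (False, z) (False, w) = B31 x z w y"
| "block_at_row_False x (True, y) (True, z) (True, w) = B31 (- y) (- z) (- w) (- x)"
| "block_at_row_False x (False, y) (True, z) (True, w) = B22 x y z w"
| "block_at_row_False x (True, y) (False, z) (True, w) = B22 x z y w"
| "block_at_row_False x (True, y) (True, z) (False, w) = B22 x w y z"

definition two_row :: "bool \<times> int \<Rightarrow> bool \<times> int \<Rightarrow> bool \<times> int \<Rightarrow> bool \<times> int \<Rightarrow> bool" where
  "two_row a b c d \<longleftrightarrow>
     (if fst a then block_at_row_False (- snd a) (opposite b) (opposite c) (opposite d)
      else block_at_row_False (snd a) b c d)"

lemma two_row_simps:
  "two_row (False, x) b c d = block_at_row_False x b c d"
  "two_row (True, x) b c d = block_at_row_False (- x) (opposite b) (opposite c) (opposite d)"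
  by (simp_all add: two_row_def)

lemma opposite_simp [simp]: "opposite (i, x) = (\<not> i, - x)"
  by (simp add: opposite_def)

lemma opposite_opposite [simp]: "opposite (opposite a) = a"
  by (cases a) simp

lemma same_point_opposite: "same_point (opposite a) (opposite b) \<longleftrightarrow> same_point a b"
  by (cases a; cases b) (simp add: same_point_def minus_diff_commute dvd_diff_commute)

lemma two_row_opposite:
  "two_row (opposite a) (opposite b) (opposite c) (opposite d) \<longleftrightarrow> two_row a b c d"
  by (cases a; cases "fst a") (simp_all add: two_row_simps)

lemma B22_opposite_iff: "B22 (- z) (- w) (- x) (- y) \<longleftrightarrow> B22 x y z w"
  using B22_opposite[of x y z w] B22_opposite[of "- z" "- w" "- x" "- y"] by auto

lemma two_row_row_False_iff:
  "two_row (False, x) (False, y) (k, z) (l, w) \<longleftrightarrow>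
     (if k then if l then B22 x y z w else B31 x y w z else if l then B31 x y z w else B40 x y z w)"
  by (cases k; cases l) (simp_all add: two_row_simps)

lemma two_row_swap:
  "two_row (i, x) (j, y) (k, z) (l, w) \<Longrightarrow> two_row (j, y) (i, x) (k, z) (l, w)"
  "two_row (i, x) (j, y) (k, z) (l, w) \<Longrightarrow> two_row (i, x) (k, z) (j, y) (l, w)"
  "two_row (i, x) (j, y) (k, z) (l, w) \<Longrightarrow> two_row (i, x) (j, y) (l, w) (k, z)"
  by (cases i; cases j; cases k; cases l; simp add: two_row_simps B22_opposite_iff;
      erule B40_swap B31_swap B22_swap)+

sublocale two_row: totally_symmetric two_row
  by (unfold_locales; unfold split_paired_all; erule two_row_swap)

lemma wlog_two_in_row_False:
  assumes "\<And>a b c. Q a b c \<Longrightarrow> Q b a c" "\<And>a b c. Q a b c \<Longrightarrow> Q a c b"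
    and "\<And>a b c. Q (opposite a) (opposite b) (opposite c) \<Longrightarrow> Q a b c"
    and "\<And>x y k z. Q (False, x) (False, y) (k, z)"
  shows "Q a b c"
proof -
  have row_False: "Q a b c" if "\<not> fst a" "\<not> fst b" for a b c
    using assms(4)[of "snd a" "snd b" "fst c" "snd c"] that by (cases a; cases b) simp
  have same_row: "Q a b c" if "fst a = fst b" for a b c
    using row_False[of a b c] row_False[of "opposite a" "opposite b" "opposite c"] assms(3) that
    by (cases "fst a") (simp_all add: opposite_def)
  consider "fst a = fst b" | "fst a = fst c" | "fst b = fst c"
    by blast
  then show ?thesis
    using same_row assms(1,2) by cases blast+
qed

lemma two_row_same_point:
  assumes "two_row a b c d" "same_point d d'"
  shows "two_row a b c d'"
proof -
  define Q where "Q a b c \<longleftrightarrow>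
    (\<forall>d d'. two_row a b c d \<longrightarrow> same_point d d' \<longrightarrow> two_row a b c d')" for a b c
  have "Q a b c"
  proof (rule wlog_two_in_row_False)
    show "Q b a c" "Q a c b" if "Q a b c" for a b c
      using that two_row.swap12 two_row.swap23 unfolding Q_def by blast+
    show "Q a b c" if "Q (opposite a) (opposite b) (opposite c)" for a b c
      using that two_row_opposite same_point_opposite unfolding Q_def by meson
    show "Q (False, x) (False, y) (k, z)" for x y k z
      unfolding Q_def split_paired_All two_row_row_False_iff same_point_def
      by (cases k) (auto split: if_splits intro: B40_cong B31_cong B22_cong)
  qed
  then show ?thesis
    using assms unfolding Q_def by blast
qed

lemma two_row_irrefl:
  assumes "two_row a b c d"
  shows "\<not> same_point a b"
proof -
  have row_False: "\<not> same_point a b" if "two_row a b c d" "\<not> fst a" for a b c d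
    using that B40_irrefl B31_irrefl B22_irrefl
    by (cases a; cases b; cases c; cases d)
      (auto simp: same_point_def two_row_row_False_iff split: if_splits)
  show ?thesis
    using row_False[OF assms] row_False[of "opposite a" "opposite b"] assms two_row_opposite
      same_point_opposite by (metis fst_map_prod opposite_def)
qed

lemma opposite_translate: "opposite (translate t a) = translate (- t) (opposite a)"
  by (cases a) simp

lemma two_row_add:
  assumes "two_row a b c d"
  shows "two_row (translate t a) (translate t b) (translate t c) (translate t d)"
proof -
  define Q where "Q a b c \<longleftrightarrow> (\<forall>d t. two_row a b c d \<longrightarrow>
    two_row (translate t a) (translate t b) (translate t c) (translate t d))" for a b c
  have "Q a b c"
  proof (rule wlog_two_in_row_False)
    show "Q b a c" "Q a c b" if "Q a b c" for a b c
      using that two_row.swap12 two_row.swap23 unfolding Q_def by blast+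
    show "Q a b c" if "Q (opposite a) (opposite b) (opposite c)" for a b c
      unfolding Q_def
    proof (intro allI impI)
      fix d t
      assume "two_row a b c d"
      then have "two_row (translate (- t) (opposite a)) (translate (- t) (opposite b))
          (translate (- t) (opposite c)) (translate (- t) (opposite d))"
        using that unfolding Q_def by (simp only: two_row_opposite)
      then show "two_row (translate t a) (translate t b) (translate t c) (translate t d)"
        by (simp only: two_row_opposite flip: opposite_translate)
    qed
    show "Q (False, x) (False, y) (k, z)" for x y k z
      unfolding Q_def split_paired_All apsnd_conv two_row_row_False_iff
      by (simp add: B40_add B31_add B22_add split: if_splits)
  qed
  then show ?thesis
    using assms unfolding Q_def by blast
qed

lemma two_row_completion:
  assumes "\<not> same_point a b" "\<not> same_point a c" "\<not> same_point b c"
  shows "\<exists>d. two_row a b c d"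
proof -
  define Q where "Q a b c \<longleftrightarrow>
    (\<not> same_point a b \<longrightarrow> \<not> same_point a c \<longrightarrow> \<not> same_point b c \<longrightarrow> (\<exists>d. two_row a b c d))" for a b c
  have same_point_sym: "same_point a b \<longleftrightarrow> same_point b a" for a b
    by (auto simp: same_point_def dvd_diff_commute)
  have "Q a b c"
  proof (rule wlog_two_in_row_False)
    show "Q b a c" "Q a c b" if "Q a b c" for a b c
      using that two_row.swap12 two_row.swap23 same_point_sym unfolding Q_def by metis+
    show "Q a b c" if "Q (opposite a) (opposite b) (opposite c)" for a b c
      using that unfolding Q_def
      by (metis two_row_opposite same_point_opposite opposite_opposite)
    show "Q (False, x) (False, y) (k, z)" for x y k z
      unfolding Q_def split_paired_Ex two_row_row_False_iff
      using B31_or_B22[of x y z] B40_or_B31[of x y z]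
      by (cases k) (auto simp: same_point_def ex_bool_eq)
  qed
  then show ?thesis
    using assms unfolding Q_def by blast
qed

lemma two_row_unique:
  assumes "two_row a b c d" "two_row a b c d'"
  shows "same_point d d'"
proof -
  define Q where "Q a b c \<longleftrightarrow>
    (\<forall>d d'. two_row a b c d \<longrightarrow> two_row a b c d' \<longrightarrow> same_point d d')" for a b c
  have "Q a b c"
  proof (rule wlog_two_in_row_False)
    show "Q b a c" "Q a c b" if "Q a b c" for a b c
      using that two_row.swap12 two_row.swap23 unfolding Q_def by blast+
    show "Q a b c" if "Q (opposite a) (opposite b) (opposite c)" for a b c
      using that two_row_opposite same_point_opposite unfolding Q_def by meson
    show "Q (False, x) (False, y) (k, z)" for x y k z
      unfolding Q_def split_paired_All two_row_row_False_iff same_point_def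
      using B40_unique[of x y z] B40_not_B31[of x y z] B31_fourth_unique[of x y z]
        B22_unique[of x y z] B22_not_B31[of x y z] B31_third_unique[of x y _ z]
      by (auto split: if_splits)
  qed
  then show ?thesis
    using assms unfolding Q_def by blast
qed

sublocale cyclic_quadruple_relation p two_row 2 "\<lambda>i. i = 1"
proof
  have "{..<2} = {0, 1 :: nat}"
    by auto
  then show "bij_betw (\<lambda>i :: nat. i = 1) {..<2} UNIV"
    by (auto simp: bij_betw_def inj_on_def UNIV_bool)
qed (fact p_gt_4 two_row_same_point two_row_irrefl two_row_completion two_row_unique two_row_add)+

end

section \<open>The quadratic character\<close>

lemma Legendre_eq_0_iff: "Legendre a p = 0 \<longleftrightarrow> p dvd a"
  by (simp add: Legendre_def cong_0_iff)

lemma Legendre_cases: "Legendre a p = 0 \<or> Legendre a p = 1 \<or> Legendre a p = - 1"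
  by (simp add: Legendre_def)

lemma Legendre_cong: "[a = b] (mod p) \<Longrightarrow> Legendre a p = Legendre b p"
  unfolding Legendre_def QuadRes_def by (simp add: cong_def)

lemma Legendre_eqI:
  assumes "2 < p" "[Legendre a p = x] (mod p)" "x = 0 \<or> x = 1 \<or> x = - 1"
  shows "Legendre a p = x"
proof -
  have "\<bar>Legendre a p - x\<bar> < p"
    using assms(1,3) Legendre_cases[of a p] by auto
  then show ?thesis
    using assms(2) zdvd_imp_le[of p "\<bar>Legendre a p - x\<bar>"] by (force simp: cong_iff_dvd_diff)
qed

lemma Legendre_mult:
  assumes "prime p" "2 < p"
  shows "Legendre (a * b) (int p) = Legendre a (int p) * Legendre b (int p)"
proof (rule Legendre_eqI)
  let ?h = "(p - 1) div 2"
  have "[Legendre (a * b) (int p) = a ^ ?h * b ^ ?h] (mod int p)"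
    using euler_criterion[OF assms, of "a * b"] by (simp add: power_mult_distrib)
  also have "[a ^ ?h * b ^ ?h = Legendre a (int p) * Legendre b (int p)] (mod int p)"
    by (intro cong_mult cong_sym[OF euler_criterion] assms)
  finally show "[Legendre (a * b) (int p) = Legendre a (int p) * Legendre b (int p)] (mod int p)" .
qed (use assms(2) Legendre_cases[of a "int p"] Legendre_cases[of b "int p"] in auto)

lemma Legendre_uminus:
  assumes "prime p" "p mod 4 = 3"
  shows "Legendre (- a) (int p) = - Legendre a (int p)"
proof -
  have "2 < p"
    using assms(2) prime_ge_2_nat[OF assms(1)] by (cases "p = 2") auto
  have "odd ((p - 1) div 2)"
    using assms(2) by presburger
  then have "Legendre (- 1) (int p) = - 1"
    using euler_criterion[OF assms(1) \<open>2 < p\<close>, of "- 1"] \<open>2 < p\<close> by (intro Legendre_eqI) simp_all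
  then show ?thesis
    using Legendre_mult[OF assms(1) \<open>2 < p\<close>, of "- 1" a] by simp
qed

section \<open>Primes congruent to 7 modulo 12\<close>

lemma primitive_cube_root_of_unity_exists:
  assumes "prime p" "p mod 3 = 1"
  shows "\<exists>w::int. int p dvd w\<^sup>2 + w + 1"
proof -
  have "2 < p"
    using assms prime_ge_2_nat[of p] by (cases "p = 2") auto
  then obtain g where primroot: "residue_primroot p g"
    using residue_primroot_odd_prime_power_exists[of p] assms(1)
    by (metis One_nat_def power_one_right prime_odd_nat zero_less_one)
  define n where "n = (p - 1) div 3"
  have n_eq: "p - 1 = n * 3" "0 < n"
    using assms(2) \<open>2 < p\<close> unfolding n_def by presburger+
  have power_eq_1_iff: "int p dvd int g ^ k - 1 \<longleftrightarrow> p - 1 dvd k" for k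
  proof -
    have "int p dvd int g ^ k - 1 \<longleftrightarrow> [g ^ k = 1] (mod p)"
      by (simp flip: cong_iff_dvd_diff cong_int_iff)
    then show ?thesis
      using primroot assms(1) by (simp add: ord_divides' residue_primroot_def totient_prime)
  qed
  define w where "w = int g ^ n"
  have "int p dvd w ^ 3 - 1"
    using power_eq_1_iff[of "n * 3"] n_eq(1) by (simp add: w_def power_mult)
  then have "int p dvd (w - 1) * (w\<^sup>2 + w + 1)"
    by (simp add: algebra_simps power2_eq_square power3_eq_cube)
  moreover have "\<not> int p dvd w - 1"
    using power_eq_1_iff[of n] n_eq by (auto simp: w_def dest: dvd_imp_le)
  ultimately show ?thesis
    using assms(1) by (auto simp: prime_dvd_mult_iff)
qed

locale equianharmonic_construction = prime_modulus +
  fixes e :: int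
  assumes p_mod_12: "p mod 12 = 7" and e_root: "P dvd e\<^sup>2 - e + 1"
begin

abbreviation \<chi> :: "int \<Rightarrow> int" where "\<chi> a \<equiv> Legendre a P"

definition positive :: "int \<Rightarrow> int \<Rightarrow> int \<Rightarrow> bool" where
  "positive x y z \<longleftrightarrow> \<chi> ((x - y) * (y - z) * (z - x)) = 1"

(* The cross ratio of (x, y; z, w) is e; equilateral is the limiting case where w is infinite. *)
definition equianharmonic :: "int \<Rightarrow> int \<Rightarrow> int \<Rightarrow> int \<Rightarrow> bool" where
  "equianharmonic x y z w \<longleftrightarrow> P dvd (x - z) * (y - w) - e * (y - z) * (x - w)"

definition equilateral :: "int \<Rightarrow> int \<Rightarrow> int \<Rightarrow> bool" where
  "equilateral x y z \<longleftrightarrow> P dvd (x - z) - e * (y - z)"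

definition B40 :: "int \<Rightarrow> int \<Rightarrow> int \<Rightarrow> int \<Rightarrow> bool" where
  "B40 x y z w \<longleftrightarrow>
     positive x y z \<and> equianharmonic x y z w \<or> positive y x z \<and> equianharmonic y x z w"

definition B31 :: "int \<Rightarrow> int \<Rightarrow> int \<Rightarrow> int \<Rightarrow> bool" where
  "B31 x y z w \<longleftrightarrow> P dvd 3 * w - (x + y + z) \<and>
     (positive x y z \<and> equilateral x y z \<or> positive y x z \<and> equilateral y x z)"

definition partner :: "int \<Rightarrow> int" where
  "partner i = (if odd i then i + 1 else i - 1)"

definition paired :: "int \<Rightarrow> int \<Rightarrow> int \<Rightarrow> int \<Rightarrow> int \<Rightarrow> bool" where
  "paired w s i c d \<longleftrightarrow>
     0 < i \<and> i < P \<and> P dvd c - (w + i * s) \<and> P dvd d - (w + partner i * s)"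

definition B22 :: "int \<Rightarrow> int \<Rightarrow> int \<Rightarrow> int \<Rightarrow> bool" where
  "B22 x y c d \<longleftrightarrow> (\<exists>z w i. B31 x y z w \<and> paired w (y - x) i c d)"

lemma p_ge_7: "7 \<le> p"
  using p_mod_12 by (metis mod_less_eq_dividend)

lemma p_gt_4: "4 < p"
  using p_ge_7 by simp

lemma odd_P: "odd P"
  using p_mod_12 by simp presburger

lemma not_P_dvd_3: "\<not> P dvd 3"
  using p_ge_7 by (simp add: zdvd_not_zless)

lemma e_nonzero: "\<not> P dvd e" "\<not> P dvd 1 - e"
proof -
  have "\<not> P dvd 1"
    using p_ge_7 by (simp add: zdvd_not_zless)
  moreover have "P dvd 1" if "P dvd e \<or> P dvd 1 - e"
    using that e_root by (elim disjE) (Groebner_Basis.algebra, Groebner_Basis.algebra)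
  ultimately show "\<not> P dvd e" "\<not> P dvd 1 - e"
    by blast+
qed

lemma chi_mult: "\<chi> (a * b) = \<chi> a * \<chi> b"
  using Legendre_mult prime_p p_gt_4 by simp

lemma chi_uminus: "\<chi> (- a) = - \<chi> a"
proof -
  have "p mod 4 = 3"
    using p_mod_12 by presburger
  then show ?thesis
    using Legendre_uminus prime_p by simp
qed

lemma chi_cong: "P dvd a - b \<Longrightarrow> \<chi> a = \<chi> b"
  by (simp add: Legendre_cong cong_iff_dvd_diff)

lemma chi_square: "\<not> P dvd a \<Longrightarrow> \<chi> (a * a) = 1"
  unfolding chi_mult using Legendre_cases[of a P] Legendre_eq_0_iff[of a P] by auto

lemma chi_swap: "\<chi> (y - x) = - \<chi> (x - y)"
  using chi_uminus[of "x - y"] by simp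

subsection \<open>Oriented triples\<close>

lemma positive_cyclic: "positive x y z \<Longrightarrow> positive y z x"
  unfolding positive_def by (simp add: ac_simps)

lemma positive_imp_distinct:
  assumes "positive x y z"
  shows "\<not> P dvd x - y" "\<not> P dvd y - z" "\<not> P dvd x - z"
proof -
  have "\<not> P dvd (x - y) * (y - z) * (z - x)"
    using assms unfolding positive_def by (metis Legendre_eq_0_iff zero_neq_one)
  then show "\<not> P dvd x - y" "\<not> P dvd y - z" "\<not> P dvd x - z"
    by (simp_all add: P_dvd_mult_iff dvd_diff_commute)
qed

lemma positive_swap_iff:
  assumes "\<not> P dvd x - y" "\<not> P dvd y - z" "\<not> P dvd x - z"
  shows "positive y x z \<longleftrightarrow> \<not> positive x y z"
proof -
  let ?v = "(x - y) * (y - z) * (z - x)"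
  have "\<not> P dvd ?v"
    using assms by (simp add: P_dvd_mult_iff dvd_diff_commute)
  moreover have "(y - x) * (x - z) * (z - y) = - ?v"
    by (simp add: algebra_simps)
  ultimately show ?thesis
    unfolding positive_def
    using chi_uminus[of ?v] Legendre_cases[of ?v P] Legendre_eq_0_iff[of ?v P] by auto
qed

lemma not_positive_swap: "positive x y z \<Longrightarrow> \<not> positive y x z"
  using positive_swap_iff positive_imp_distinct by blast

lemma positive_add: "positive (x + t) (y + t) (z + t) \<longleftrightarrow> positive x y z"
  unfolding positive_def by simp

subsection \<open>Equianharmonic quadruples\<close>

lemma equianharmonic_cyclic: "equianharmonic x y z w \<Longrightarrow> equianharmonic z x y w"
  unfolding equianharmonic_def using e_root by Groebner_Basis.algebra

lemma equianharmonic_swap: "equianharmonic x y z w \<longleftrightarrow> equianharmonic y x w z"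
  unfolding equianharmonic_def by (simp add: algebra_simps)

lemma equianharmonic_imp_distinct:
  assumes "equianharmonic x y z w" "\<not> P dvd x - y" "\<not> P dvd y - z" "\<not> P dvd x - z"
  shows "\<not> P dvd x - w" "\<not> P dvd y - w"
proof -
  have "P dvd (x - z) * (x - y)" if "P dvd x - w"
    using that assms(1) unfolding equianharmonic_def by Groebner_Basis.algebra
  then show "\<not> P dvd x - w"
    using assms by (auto simp: P_dvd_mult_iff)
  have "P dvd e * ((y - z) * (x - y))" if "P dvd y - w"
    using that assms(1) unfolding equianharmonic_def by Groebner_Basis.algebra
  then show "\<not> P dvd y - w"
    using assms e_nonzero by (auto simp: P_dvd_mult_iff)
qed

(* The product of the two orientations is a square, because - e = e^4 is one. *)
lemma positive_equianharmonic:
  assumes "positive x y z" "equianharmonic x y z w"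
  shows "positive y x w"
proof -
  note xyz = positive_imp_distinct[OF assms(1)]
  define s where "s = e * e * (x - y) * (y - z) * (x - w)"
  have "\<not> P dvd s"
    unfolding s_def using xyz equianharmonic_imp_distinct[OF assms(2) xyz] e_nonzero
    by (simp add: P_dvd_mult_iff)
  moreover have "P dvd (x - y) * (y - z) * (z - x) * ((y - x) * (x - w) * (w - y)) - s * s"
    using assms(2) e_root unfolding equianharmonic_def s_def by Groebner_Basis.algebra
  ultimately have "\<chi> ((x - y) * (y - z) * (z - x)) * \<chi> ((y - x) * (x - w) * (w - y)) = 1"
    by (metis chi_cong chi_mult chi_square)
  then show ?thesis
    using assms(1) unfolding positive_def by simp
qed

lemma equianharmonic_add:
  "equianharmonic (x + t) (y + t) (z + t) (w + t) \<longleftrightarrow> equianharmonic x y z w"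
  unfolding equianharmonic_def by simp

lemma equianharmonic_cong: "equianharmonic x y z w \<Longrightarrow> P dvd w - w' \<Longrightarrow> equianharmonic x y z w'"
  unfolding equianharmonic_def by Groebner_Basis.algebra

lemma equianharmonic_or_equilateral: "(\<exists>w. equianharmonic x y z w) \<or> equilateral x y z"
proof (cases "equilateral x y z")
  case False
  then obtain w where "P dvd ((x - z) - e * (y - z)) * w - ((x - z) * y - e * (y - z) * x)"
    using exists_quotient unfolding equilateral_def by blast
  then have "equianharmonic x y z w"
    unfolding equianharmonic_def by Groebner_Basis.algebra
  then show ?thesis
    by blast
qed simp

lemma equianharmonic_not_equilateral:
  assumes "positive x y z" "equianharmonic x y z w"
  shows "\<not> equilateral x y z"
proof
  assume "equilateral x y z"
  then have "P dvd e * ((y - z) * (x - y))"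
    using assms(2) unfolding equianharmonic_def equilateral_def by Groebner_Basis.algebra
  then show False
    using positive_imp_distinct[OF assms(1)] e_nonzero by (simp add: P_dvd_mult_iff)
qed

lemma equianharmonic_unique:
  assumes "positive x y z" "equianharmonic x y z w" "equianharmonic x y z w'"
  shows "P dvd w - w'"
proof -
  have "P dvd ((x - z) - e * (y - z)) * (w - w')"
    using assms(2,3) unfolding equianharmonic_def by Groebner_Basis.algebra
  then show ?thesis
    using equianharmonic_not_equilateral[OF assms(1,2)] P_dvd_mult_iff
    unfolding equilateral_def by blast
qed

lemma B40_swap:
  "B40 x y z w \<Longrightarrow> B40 y x z w" "B40 x y z w \<Longrightarrow> B40 x z y w" "B40 x y z w \<Longrightarrow> B40 x y w z"
proof -
  assume B40: "B40 x y z w"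
  then show "B40 y x z w"
    unfolding B40_def by blast
  show "B40 x z y w"
    using B40 unfolding B40_def by (meson positive_cyclic equianharmonic_cyclic)
  show "B40 x y w z"
    using B40 unfolding B40_def using positive_equianharmonic equianharmonic_swap by blast
qed

lemma B40_add: "B40 x y z w \<Longrightarrow> B40 (x + t) (y + t) (z + t) (w + t)"
  unfolding B40_def by (simp add: positive_add equianharmonic_add)

lemma B40_cong: "B40 x y z w \<Longrightarrow> P dvd w - w' \<Longrightarrow> B40 x y z w'"
  unfolding B40_def using equianharmonic_cong by blast

lemma B40_irrefl: "B40 x y z w \<Longrightarrow> \<not> P dvd x - y"
  unfolding B40_def
  using positive_imp_distinct(1)[of x y z] positive_imp_distinct(1)[of y x z]
    dvd_diff_commute[of P x y]
  by blast

lemma B40_unique: "B40 x y z w \<Longrightarrow> B40 x y z w' \<Longrightarrow> P dvd w - w'"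
  unfolding B40_def using equianharmonic_unique not_positive_swap by blast

subsection \<open>Equilateral triangles with their centres\<close>

lemma equilateral_cyclic: "equilateral x y z \<Longrightarrow> equilateral z x y"
  unfolding equilateral_def using e_root by Groebner_Basis.algebra

lemma equilateral_add: "equilateral (x + t) (y + t) (z + t) \<longleftrightarrow> equilateral x y z"
  unfolding equilateral_def by simp

lemma equilateral_cong: "equilateral x y z \<Longrightarrow> P dvd z - z' \<Longrightarrow> equilateral x y z'"
  unfolding equilateral_def by Groebner_Basis.algebra

lemma equilateral_unique:
  assumes "equilateral x y z" "equilateral x y z'"
  shows "P dvd z - z'"
proof -
  have "P dvd (1 - e) * (z - z')"
    using assms unfolding equilateral_def by Groebner_Basis.algebra
  then show ?thesis
    using e_nonzero by (simp add: P_dvd_mult_iff)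
qed

lemma positive_iff_of_equilateral:
  assumes "equilateral x y z"
  shows "positive x y z \<longleftrightarrow> \<chi> (x - y) = 1"
proof -
  define s where "s = y - z"
  have "P dvd (x - y) * (y - z) * (z - x) - s * s * s" "P dvd (x - y) - e * e * s"
    using assms e_root unfolding equilateral_def s_def by Groebner_Basis.algebra+
  then have "\<chi> ((x - y) * (y - z) * (z - x)) = \<chi> (s * s * s)" "\<chi> (x - y) = \<chi> (e * e) * \<chi> s"
    by (simp_all only: chi_cong chi_mult[of "e * e"])
  moreover have "\<chi> (s * s * s) = \<chi> s"
    using Legendre_cases[of s P] by (auto simp: chi_mult)
  ultimately show ?thesis
    unfolding positive_def using chi_square[OF e_nonzero(1)] by simp
qed

lemma B31_iff_chi:
  "B31 x y z w \<longleftrightarrow> P dvd 3 * w - (x + y + z) \<and>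
     (\<chi> (x - y) = 1 \<and> equilateral x y z \<or> \<chi> (x - y) = - 1 \<and> equilateral y x z)"
  unfolding B31_def using positive_iff_of_equilateral chi_swap[of y x] by auto

lemma B31_swap: "B31 x y z w \<Longrightarrow> B31 y x z w" "B31 x y z w \<Longrightarrow> B31 x z y w"
proof -
  assume B31: "B31 x y z w"
  then show "B31 y x z w"
    unfolding B31_def by (auto simp: ac_simps)
  show "B31 x z y w"
    using B31 unfolding B31_def by (simp add: ac_simps) (meson positive_cyclic equilateral_cyclic)
qed

lemma B31_add: "B31 x y z w \<Longrightarrow> B31 (x + t) (y + t) (z + t) (w + t)"
proof -
  have "3 * (w + t) - (x + t + (y + t) + (z + t)) = 3 * w - (x + y + z)"
    by simp
  then show "B31 x y z w \<Longrightarrow> ?thesis"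
    unfolding B31_def positive_add equilateral_add by metis
qed

lemma B31_cong:
  "B31 x y z w \<Longrightarrow> P dvd w - w' \<Longrightarrow> B31 x y z w'"
  "B31 x y z w \<Longrightarrow> P dvd z - z' \<Longrightarrow> B31 x y z' w"
proof -
  have "P dvd 3 * w' - s" if "P dvd w - w'" "P dvd 3 * w - s" for s
    using that by Groebner_Basis.algebra
  then show "B31 x y z w \<Longrightarrow> P dvd w - w' \<Longrightarrow> B31 x y z w'"
    unfolding B31_iff_chi by blast
  have "P dvd 3 * w - (x + y + z')" if "P dvd z - z'" "P dvd 3 * w - (x + y + z)"
    using that by Groebner_Basis.algebra
  then show "B31 x y z w \<Longrightarrow> P dvd z - z' \<Longrightarrow> B31 x y z' w"
    unfolding B31_iff_chi using equilateral_cong by blast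
qed

lemma B31_irrefl: "B31 x y z w \<Longrightarrow> \<not> P dvd x - y"
  unfolding B31_def
  using positive_imp_distinct(1)[of x y z] positive_imp_distinct(1)[of y x z]
    dvd_diff_commute[of P x y]
  by blast

lemma exists_centre: "\<exists>w. P dvd 3 * w - a"
  using exists_quotient not_P_dvd_3 by blast

lemma B31_exists:
  assumes "\<not> P dvd x - y"
  shows "\<exists>z w. B31 x y z w"
proof -
  have exists_third: "\<exists>z. equilateral x y z" for x y
  proof -
    obtain z where "P dvd (1 - e) * z - (x - e * y)"
      using exists_quotient e_nonzero by blast
    then have "equilateral x y z"
      unfolding equilateral_def by Groebner_Basis.algebra
    then show ?thesis ..
  qed
  have "\<chi> (x - y) = 1 \<or> \<chi> (x - y) = - 1"
    using assms Legendre_cases[of "x - y" P] Legendre_eq_0_iff[of "x - y" P] by auto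
  then show ?thesis
    unfolding B31_iff_chi using exists_third exists_centre by blast
qed

lemma B31_determined:
  assumes "B31 x y z w" "B31 x y z' w'"
  shows "P dvd z - z'" "P dvd w - w'"
proof -
  show "P dvd z - z'"
    using assms equilateral_unique unfolding B31_iff_chi by auto
  then have "P dvd 3 * (w - w')"
    using assms unfolding B31_iff_chi by Groebner_Basis.algebra
  then show "P dvd w - w'"
    using not_P_dvd_3 P_dvd_mult_iff by blast
qed

lemma B40_or_B31:
  assumes "\<not> P dvd x - y" "\<not> P dvd x - z" "\<not> P dvd y - z"
  shows "(\<exists>w. B40 x y z w) \<or> (\<exists>w. B31 x y z w)"
proof -
  have "positive x y z \<or> positive y x z"
    using positive_swap_iff assms by blast
  then show ?thesis
    unfolding B40_def B31_def using equianharmonic_or_equilateral exists_centre by blast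
qed

lemma B40_not_B31: "B40 x y z w \<Longrightarrow> \<not> B31 x y z w'"
  unfolding B40_def B31_def using equianharmonic_not_equilateral not_positive_swap by blast

subsection \<open>Pairing the remaining points\<close>

lemma partner_in_range: "0 < i \<Longrightarrow> i < P \<Longrightarrow> 0 < partner i \<and> partner i < P"
  unfolding partner_def using odd_P by presburger

lemma partner_partner: "partner (partner i) = i"
  by (simp add: partner_def)

lemma partner_reflect: "partner (P - i) = P - partner i"
  using odd_P by (simp add: partner_def)

lemma odd_partner_iff: "odd (partner i) \<longleftrightarrow> even i"
  by (simp add: partner_def)

lemma paired_commute: "paired w s i c d \<Longrightarrow> paired w s (partner i) d c"
  unfolding paired_def using partner_in_range by (simp add: partner_partner)

lemma paired_reflect:
  assumes "paired w s i c d"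
  shows "paired w (- s) (P - i) c d"
proof -
  have "P dvd a - (w + (P - j) * - s)" if "P dvd a - (w + j * s)" for a j
    using that by Groebner_Basis.algebra
  then show ?thesis
    using assms unfolding paired_def partner_reflect by auto
qed

lemma paired_cong:
  assumes "paired w s i c d" "P dvd w - w'" "P dvd d - d'"
  shows "paired w' s i c d'"
proof -
  have "P dvd c - (w' + i * s)" "P dvd d' - (w' + partner i * s)"
    using assms unfolding paired_def by (elim conjE, Groebner_Basis.algebra)+
  then show ?thesis
    using assms(1) unfolding paired_def by blast
qed

lemma paired_add: "paired w s i c d \<Longrightarrow> paired (w + t) s i (c + t) (d + t)"
  unfolding paired_def by (simp add: algebra_simps)

lemma paired_unique:
  assumes "paired w s i c d" "paired w s j c d'" "\<not> P dvd s"
  shows "P dvd d - d'"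
proof -
  have offset: "0 < i" "i < P" "P dvd c - (w + i * s)" "P dvd d - (w + partner i * s)"
    and offset': "0 < j" "j < P" "P dvd c - (w + j * s)" "P dvd d' - (w + partner j * s)"
    using assms(1,2) unfolding paired_def by simp_all
  have "P dvd (i - j) * s"
    using offset(3) offset'(3) by Groebner_Basis.algebra
  then have "P dvd i - j"
    using assms(3) by (simp add: P_dvd_mult_iff)
  then have "i = j"
    using offset(1,2) offset'(1,2) by (simp flip: mod_eq_dvd_iff)
  show ?thesis
    using offset(4) offset'(4) unfolding \<open>i = j\<close> by Groebner_Basis.algebra
qed

lemma not_paired_centre: "paired w s i w d \<Longrightarrow> P dvd s"
proof -
  assume paired: "paired w s i w d"
  then have "P dvd w - (w + i * s)"
    unfolding paired_def by blast
  then have "P dvd i * s"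
    by Groebner_Basis.algebra
  then show "P dvd s"
    using paired by (auto simp: paired_def P_dvd_mult_iff zdvd_not_zless)
qed

lemma centre_or_paired:
  assumes "\<not> P dvd s"
  shows "P dvd w - c \<or> (\<exists>i d. paired w s i c d)"
proof -
  obtain t where quotient: "P dvd s * t - (c - w)"
    using exists_quotient assms by blast
  define i where "i = t mod P"
  have residue: "0 \<le> i" "i < P" "P dvd t - i"
    using P_pos unfolding i_def by (simp_all flip: mod_eq_dvd_iff)
  then have c_eq: "P dvd c - (w + i * s)"
    using quotient by Groebner_Basis.algebra
  show ?thesis
  proof (cases "i = 0")
    case True
    then show ?thesis
      using c_eq by (simp add: dvd_diff_commute)
  next
    case False
    then have "paired w s i c (w + partner i * s)"
      using residue c_eq unfolding paired_def by simp
    then show ?thesis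
      by blast
  qed
qed

lemma B22_swap: "B22 x y c d \<Longrightarrow> B22 y x c d" "B22 x y c d \<Longrightarrow> B22 x y d c"
proof -
  assume "B22 x y c d"
  then obtain z w i where pairing: "B31 x y z w" "paired w (y - x) i c d"
    unfolding B22_def by blast
  then show "B22 x y d c"
    unfolding B22_def using paired_commute by blast
  have "paired w (x - y) (P - i) c d"
    using paired_reflect[OF pairing(2)] by simp
  then show "B22 y x c d"
    unfolding B22_def using pairing(1) B31_swap(1) by blast
qed

(* For odd i, translating the triangle by - d - x carries y to - c, and the step d - c is y - x. *)
lemma B22_opposite_of_odd:
  assumes "B31 x y z w" "paired w (y - x) i c d" "odd i"
  shows "B22 (- c) (- d) (- x) (- y)"
proof -
  define t where "t = - d - x"
  have partner: "partner i = i + 1"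
    using assms(3) by (simp add: partner_def)
  have bounds: "0 < i" "i < P"
    and offsets: "P dvd c - (w + i * (y - x))" "P dvd d - (w + (i + 1) * (y - x))"
    using assms(2) unfolding paired_def partner by simp_all
  have "B31 (x + t) (z + t) (y + t) (w + t)"
    using assms(1) B31_swap B31_add by blast
  moreover have "x + t = - d" "P dvd (y + t) - (- c)"
    using offsets unfolding t_def by (simp, Groebner_Basis.algebra)
  ultimately have "B31 (- d) (- c) (z + t) (w + t)"
    using B31_cong(2) B31_swap(2) by metis
  moreover have "P dvd - y - (w + t + i * (- c - (- d)))"
    "P dvd - x - (w + t + (i + 1) * (- c - (- d)))"
    using offsets unfolding t_def by Groebner_Basis.algebra+
  ultimately have "B22 (- d) (- c) (- y) (- x)"
    using bounds unfolding B22_def paired_def partner[symmetric] by blast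
  then show ?thesis
    using B22_swap by blast
qed

lemma B22_opposite:
  assumes "B22 x y c d"
  shows "B22 (- c) (- d) (- x) (- y)"
proof -
  obtain z w i where pairing: "B31 x y z w" "paired w (y - x) i c d"
    using assms unfolding B22_def by blast
  show ?thesis
  proof (cases "odd i")
    case True
    then show ?thesis
      using B22_opposite_of_odd pairing by blast
  next
    case False
    then have "B22 (- d) (- c) (- x) (- y)"
      using B22_opposite_of_odd[OF pairing(1) paired_commute[OF pairing(2)]]
      by (simp add: odd_partner_iff)
    then show ?thesis
      using B22_swap by blast
  qed
qed

lemma B22_add: "B22 x y c d \<Longrightarrow> B22 (x + t) (y + t) (c + t) (d + t)"
  unfolding B22_def add_diff_cancel_right using B31_add paired_add by blast

lemma B22_cong: "B22 x y c d \<Longrightarrow> P dvd d - d' \<Longrightarrow> B22 x y c d'"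
  unfolding B22_def using paired_cong by (metis diff_self dvd_0_right)

lemma B22_irrefl: "B22 x y c d \<Longrightarrow> \<not> P dvd x - y"
  unfolding B22_def using B31_irrefl by blast

lemma B22_imp_paired:
  assumes "B22 x y c d" "B31 x y z w"
  shows "\<exists>i. paired w (y - x) i c d"
proof -
  obtain z' w' i where pairing: "B31 x y z' w'" "paired w' (y - x) i c d"
    using assms(1) unfolding B22_def by blast
  then show ?thesis
    using paired_cong B31_determined(2)[OF pairing(1) assms(2)] by (metis diff_self dvd_0_right)
qed

lemma B22_not_B31: "B22 x y c d \<Longrightarrow> \<not> B31 x y z c"
  using B22_imp_paired not_paired_centre B22_irrefl by (metis dvd_diff_commute)

lemma B22_unique:
  assumes "B22 x y c d" "B22 x y c d'"
  shows "P dvd d - d'"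
proof -
  obtain z w where "B31 x y z w"
    using assms(1) unfolding B22_def by blast
  then obtain i j where "paired w (y - x) i c d" "paired w (y - x) j c d'"
    using B22_imp_paired assms by blast
  moreover have "\<not> P dvd y - x"
    using B22_irrefl[OF assms(1)] by (simp add: dvd_diff_commute)
  ultimately show ?thesis
    by (rule paired_unique)
qed

lemma B31_or_B22:
  assumes "\<not> P dvd x - y"
  shows "(\<exists>z. B31 x y z c) \<or> (\<exists>d. B22 x y c d)"
proof -
  obtain z w where "B31 x y z w"
    using B31_exists[OF assms] by blast
  moreover have "\<not> P dvd y - x"
    using assms by (simp add: dvd_diff_commute)
  ultimately show ?thesis
    using centre_or_paired[of "y - x" w c] B31_cong(1) unfolding B22_def by blast
qed

sublocale doubling p B40 B31 B22
  by unfold_locales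
    (fact p_gt_4 B40_swap B31_swap B22_swap B22_opposite B40_add B31_add B22_add
      B40_cong B31_cong B22_cong B40_irrefl B31_irrefl B22_irrefl B40_or_B31 B40_not_B31
      B40_unique B31_determined B31_or_B22 B22_not_B31 B22_unique)+

end

lemma strictly_cyclic_SQS_7_mod_12:
  assumes "prime p" "p mod 12 = 7"
  shows "\<exists>S. strictly_cyclic_SQS 2 p S"
proof -
  have "p mod 3 = 1"
    using assms(2) by presburger
  then obtain w where "int p dvd w\<^sup>2 + w + 1"
    using primitive_cube_root_of_unity_exists assms(1) by blast
  then interpret equianharmonic_construction p "- w"
    using assms by unfold_locales simp_all
  show ?thesis
    using strictly_cyclic_blocks by blast
qed

section \<open>Affine-invariant quadruples and harmonic pairs\<close>

(* {0, 1, l} consists of three points, none of which is the midpoint of the other two. *)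
definition (in prime_modulus) nondegenerate :: "int \<Rightarrow> bool" where
  "nondegenerate l \<longleftrightarrow>
     \<not> P dvd l \<and> \<not> P dvd l - 1 \<and> \<not> P dvd l + 1 \<and> \<not> P dvd l - 2 \<and> \<not> P dvd 2 * l - 1"

locale affine_construction = prime_modulus p + totally_symmetric B40
  for p :: nat and B40 :: "int \<Rightarrow> int \<Rightarrow> int \<Rightarrow> int \<Rightarrow> bool" +
  assumes p_ge_5: "5 \<le> p"
    and B40_cong: "B40 x y z w \<Longrightarrow> P dvd w - w' \<Longrightarrow> B40 x y z w'"
    and B40_affine: "B40 x y z w \<Longrightarrow> \<not> P dvd s \<Longrightarrow>
      B40 (s * x + t) (s * y + t) (s * z + t) (s * w + t)"
    and B40_irrefl: "B40 x y z w \<Longrightarrow> \<not> P dvd x - y"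
    and B40_0_1_domain: "(\<exists>m. B40 0 1 l m) \<longleftrightarrow> nondegenerate l"
    and B40_0_1_unique: "B40 0 1 l m \<Longrightarrow> B40 0 1 l m' \<Longrightarrow> P dvd m - m'"
begin

definition midpoint :: "int \<Rightarrow> int \<Rightarrow> int \<Rightarrow> bool" where
  "midpoint x y z \<longleftrightarrow> P dvd y + z - 2 * x"

definition B31 :: "int \<Rightarrow> int \<Rightarrow> int \<Rightarrow> int \<Rightarrow> bool" where
  "B31 x y z w \<longleftrightarrow> \<not> P dvd x - y \<and> \<not> P dvd y - z \<and> \<not> P dvd x - z \<and>
     (P dvd w - x \<and> midpoint x y z \<or> P dvd w - y \<and> midpoint y x z \<or> P dvd w - z \<and> midpoint z x y)"

definition harmonic :: "int \<Rightarrow> int \<Rightarrow> int \<Rightarrow> int \<Rightarrow> bool" where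
  "harmonic x y c d \<longleftrightarrow> P dvd (x - c) * (y - d) + (x - d) * (y - c)"

definition B22 :: "int \<Rightarrow> int \<Rightarrow> int \<Rightarrow> int \<Rightarrow> bool" where
  "B22 x y c d \<longleftrightarrow> \<not> P dvd x - y \<and> \<not> P dvd c - d \<and> harmonic x y c d"

lemma p_gt_4: "4 < p"
  using p_ge_5 by simp

lemma not_P_dvd_small: "\<not> P dvd 2" "\<not> P dvd 3"
  using p_ge_5 by (simp_all add: zdvd_not_zless)

subsection \<open>Affine normalization\<close>

lemma ratio_exists:
  assumes "\<not> P dvd x - y"
  shows "\<exists>l. P dvd (z - x) - l * (y - x)"
proof -
  obtain l where "P dvd (x - y) * l - (x - z)"
    using exists_quotient assms by blast
  then have "P dvd (z - x) - l * (y - x)"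
    by Groebner_Basis.algebra
  then show ?thesis ..
qed

lemma B40_cong_all:
  assumes "B40 x y z w" "P dvd x - x'" "P dvd y - y'" "P dvd z - z'" "P dvd w - w'"
  shows "B40 x' y' z' w'"
  by (rule respects_all[where E = "\<lambda>a b. P dvd a - b", OF _ assms]) (rule B40_cong)

lemma B40_iff_normalized:
  assumes "\<not> P dvd x - y" "P dvd (z - x) - l * (y - x)" "P dvd (w - x) - m * (y - x)"
  shows "B40 x y z w \<longleftrightarrow> B40 0 1 l m"
proof
  assume "B40 x y z w"
  obtain k where quotient: "P dvd (x - y) * k - (- 1)"
    using exists_quotient assms(1) by blast
  have "P dvd (k * y + - (k * x)) - 1"
    "P dvd (k * z + - (k * x)) - l" "P dvd (k * w + - (k * x)) - m"
    using quotient assms(2,3) by Groebner_Basis.algebra+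
  moreover have "P dvd (k * x + - (k * x)) - 0"
    by simp
  moreover have "\<not> P dvd k"
  proof
    assume "P dvd k"
    then have "P dvd 1"
      using quotient by Groebner_Basis.algebra
    then show False
      using p_ge_5 by (simp add: zdvd_not_zless)
  qed
  ultimately show "B40 0 1 l m"
    using B40_cong_all[OF B40_affine[OF \<open>B40 x y z w\<close>]] by blast
next
  assume "B40 0 1 l m"
  moreover have "\<not> P dvd y - x"
    using assms(1) by (simp add: dvd_diff_commute)
  ultimately have "B40 ((y - x) * 0 + x) ((y - x) * 1 + x) ((y - x) * l + x) ((y - x) * m + x)"
    by (rule B40_affine)
  then show "B40 x y z w"
    by (rule B40_cong_all) (use assms(2,3) in \<open>simp_all add: dvd_diff_commute algebra_simps\<close>)
qed

lemma B40_add: "B40 x y z w \<Longrightarrow> B40 (x + t) (y + t) (z + t) (w + t)"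
  using B40_affine[of x y z w 1 t] p_ge_5 by (simp add: zdvd_not_zless)

lemma B40_unique:
  assumes "B40 x y z w" "B40 x y z w'"
  shows "P dvd w - w'"
proof -
  have distinct: "\<not> P dvd x - y"
    using B40_irrefl[OF assms(1)] .
  obtain l m m' where normalized: "P dvd (z - x) - l * (y - x)" "P dvd (w - x) - m * (y - x)"
      "P dvd (w' - x) - m' * (y - x)"
    using ratio_exists[OF distinct] by metis
  then have "P dvd m - m'"
    using assms B40_iff_normalized[OF distinct] B40_0_1_unique by blast
  then show ?thesis
    using normalized by Groebner_Basis.algebra
qed

subsection \<open>Arithmetic progressions with their midpoints\<close>

lemma midpoint_iff_ratio:
  assumes "\<not> P dvd x - y" "P dvd (z - x) - l * (y - x)"
  shows "midpoint x y z \<longleftrightarrow> P dvd l + 1" "midpoint y x z \<longleftrightarrow> P dvd l - 2"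
    "midpoint z x y \<longleftrightarrow> P dvd 2 * l - 1"
proof -
  have cancel: "P dvd a \<longleftrightarrow> P dvd b" if "P dvd a - b * (x - y) \<or> P dvd a + b * (x - y)" for a b
  proof -
    have "P dvd a \<longleftrightarrow> P dvd b * (x - y)"
      using that by (elim disjE; intro iffI) Groebner_Basis.algebra+
    then show ?thesis
      using assms(1) by (simp add: P_dvd_mult_iff)
  qed
  show "midpoint x y z \<longleftrightarrow> P dvd l + 1"
    unfolding midpoint_def by (rule cancel, rule disjI2) (use assms(2) in Groebner_Basis.algebra)
  show "midpoint y x z \<longleftrightarrow> P dvd l - 2"
    unfolding midpoint_def by (rule cancel, rule disjI2) (use assms(2) in Groebner_Basis.algebra)
  show "midpoint z x y \<longleftrightarrow> P dvd 2 * l - 1"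
    unfolding midpoint_def by (rule cancel, rule disjI1) (use assms(2) in Groebner_Basis.algebra)
qed

lemma midpoint_commute: "midpoint x y z \<longleftrightarrow> midpoint x z y"
  by (simp add: midpoint_def add.commute)

lemma two_midpoints:
  assumes "midpoint x y z" "midpoint y x z"
  shows "P dvd x - y"
proof -
  have "P dvd 3 * (x - y)"
    using assms unfolding midpoint_def by Groebner_Basis.algebra
  then show ?thesis
    using not_P_dvd_small P_dvd_mult_iff by blast
qed

lemma B31_swap: "B31 x y z w \<Longrightarrow> B31 y x z w" "B31 x y z w \<Longrightarrow> B31 x z y w"
  unfolding B31_def using dvd_diff_commute[of P x y] dvd_diff_commute[of P y z]
    midpoint_commute[of x y z] midpoint_commute[of z x y] by blast+

lemma B31_add: "B31 x y z w \<Longrightarrow> B31 (x + t) (y + t) (z + t) (w + t)"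
  unfolding B31_def midpoint_def by (simp add: algebra_simps)

lemma B31_cong:
  "B31 x y z w \<Longrightarrow> P dvd w - w' \<Longrightarrow> B31 x y z w'"
  "B31 x y z w \<Longrightarrow> P dvd z - z' \<Longrightarrow> B31 x y z' w"
proof -
  have "P dvd w' - a" if "P dvd w - w'" "P dvd w - a" for a
    using that by Groebner_Basis.algebra
  then show "B31 x y z w \<Longrightarrow> P dvd w - w' \<Longrightarrow> B31 x y z w'"
    unfolding B31_def by blast
  assume cong: "P dvd z - z'"
  have "P dvd a - z \<longleftrightarrow> P dvd a - z'" for a
    using cong by (intro iffI) Groebner_Basis.algebra+
  moreover have "midpoint a b z \<longleftrightarrow> midpoint a b z'" "midpoint z a b \<longleftrightarrow> midpoint z' a b" for a b
    using cong unfolding midpoint_def by (intro iffI; Groebner_Basis.algebra)+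
  ultimately show "B31 x y z w \<Longrightarrow> B31 x y z' w"
    unfolding B31_def by metis
qed

lemma B31_irrefl: "B31 x y z w \<Longrightarrow> \<not> P dvd x - y"
  unfolding B31_def by blast

lemma B31_fourth_unique:
  assumes "B31 x y z w" "B31 x y z w'"
  shows "P dvd w - w'"
proof -
  have "P dvd w - w'" if "P dvd w - a" "P dvd w' - a" for a
    using that by Groebner_Basis.algebra
  then show ?thesis
    using assms two_midpoints midpoint_commute unfolding B31_def by metis
qed

lemma B31_third_unique:
  assumes "B31 x y z w" "B31 x y z' w"
  shows "P dvd z - z'"
proof -
  have "P dvd z - z'" if "midpoint a b z" "midpoint a b z'" for a b
    using that unfolding midpoint_def by Groebner_Basis.algebra
  moreover have "P dvd a - b" if "P dvd w - a" "P dvd w - b" for a b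
    using that by Groebner_Basis.algebra
  ultimately show ?thesis
    using assms unfolding B31_def by blast
qed

lemma B40_or_B31:
  assumes "\<not> P dvd x - y" "\<not> P dvd x - z" "\<not> P dvd y - z"
  shows "(\<exists>w. B40 x y z w) \<or> (\<exists>w. B31 x y z w)"
proof -
  obtain l where ratio: "P dvd (z - x) - l * (y - x)"
    using ratio_exists[OF assms(1)] by blast
  have "P dvd x - z" if "P dvd l"
    using that ratio by Groebner_Basis.algebra
  moreover have "P dvd y - z" if "P dvd l - 1"
    using that ratio by Groebner_Basis.algebra
  ultimately consider "nondegenerate l" | "midpoint x y z \<or> midpoint y x z \<or> midpoint z x y"
    using assms midpoint_iff_ratio[OF assms(1) ratio] unfolding nondegenerate_def by blast
  then show ?thesis
  proof cases
    case 1
    then obtain m where "B40 0 1 l m"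
      using B40_0_1_domain by blast
    then have "B40 x y z (x + m * (y - x))"
      using B40_iff_normalized[OF assms(1) ratio, of "x + m * (y - x)" m] by simp
    then show ?thesis
      by blast
  next
    case 2
    then have "B31 x y z x \<or> B31 x y z y \<or> B31 x y z z"
      using assms unfolding B31_def by auto
    then show ?thesis
      by blast
  qed
qed

lemma B40_not_B31:
  assumes "B40 x y z w"
  shows "\<not> B31 x y z w'"
proof -
  have distinct: "\<not> P dvd x - y"
    using B40_irrefl[OF assms] .
  obtain l m where ratios: "P dvd (z - x) - l * (y - x)" "P dvd (w - x) - m * (y - x)"
    using ratio_exists[OF distinct] by metis
  then have "nondegenerate l"
    using B40_iff_normalized[OF distinct ratios] B40_0_1_domain assms by blast
  then show ?thesis
    using midpoint_iff_ratio[OF distinct ratios(1)] unfolding nondegenerate_def B31_def by blast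
qed

subsection \<open>Harmonic pairs\<close>

lemma B22_imp_harmonic: "B22 x y c d \<Longrightarrow> harmonic x y c d"
  unfolding B22_def by blast

lemma B22_swap: "B22 x y c d \<Longrightarrow> B22 y x c d" "B22 x y c d \<Longrightarrow> B22 x y d c"
  unfolding B22_def harmonic_def using dvd_diff_commute[of P x y] dvd_diff_commute[of P c d]
  by (simp_all add: algebra_simps)

lemma B22_opposite: "B22 x y c d \<Longrightarrow> B22 (- c) (- d) (- x) (- y)"
  unfolding B22_def harmonic_def using dvd_diff_commute[of P x y] dvd_diff_commute[of P c d]
  by (simp add: algebra_simps)

lemma B22_add: "B22 x y c d \<Longrightarrow> B22 (x + t) (y + t) (c + t) (d + t)"
  unfolding B22_def harmonic_def by simp

lemma B22_cong:
  assumes "B22 x y c d" "P dvd d - d'"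
  shows "B22 x y c d'"
proof -
  have "harmonic x y c d'"
    using B22_imp_harmonic[OF assms(1)] assms(2) unfolding harmonic_def by Groebner_Basis.algebra
  moreover have "P dvd c - d" if "P dvd c - d'"
    using that assms(2) by Groebner_Basis.algebra
  ultimately show ?thesis
    using assms(1) unfolding B22_def by blast
qed

lemma B22_irrefl: "B22 x y c d \<Longrightarrow> \<not> P dvd x - y"
  unfolding B22_def by blast

lemma B22_imp_not_endpoint:
  assumes "B22 x y c d"
  shows "\<not> P dvd c - x"
proof
  assume "P dvd c - x"
  then have "P dvd (x - y) * (c - d)"
    using B22_imp_harmonic[OF assms] unfolding harmonic_def by Groebner_Basis.algebra
  then show False
    using assms unfolding B22_def P_dvd_mult_iff by blast
qed

lemma B22_imp_not_midpoint:
  assumes "B22 x y c d"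
  shows "\<not> midpoint c x y"
proof
  assume "midpoint c x y"
  then have "P dvd (x - y) * (x - y)"
    using B22_imp_harmonic[OF assms] unfolding harmonic_def midpoint_def by Groebner_Basis.algebra
  then show False
    using assms unfolding B22_def P_dvd_mult_iff by blast
qed

lemma B22_not_B31:
  assumes "B22 x y c d"
  shows "\<not> B31 x y z c"
proof -
  have "midpoint c x y" if "P dvd c - z" "midpoint z x y"
    using that unfolding midpoint_def by Groebner_Basis.algebra
  then show ?thesis
    using B22_imp_not_endpoint[OF assms] B22_imp_not_endpoint[OF B22_swap(1)[OF assms]]
      B22_imp_not_midpoint[OF assms] unfolding B31_def by blast
qed

lemma B22_unique:
  assumes "B22 x y c d" "B22 x y c d'"
  shows "P dvd d - d'"
proof -
  have "P dvd (x + y - 2 * c) * (d - d')"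
    using assms[THEN B22_imp_harmonic] unfolding harmonic_def by Groebner_Basis.algebra
  then show ?thesis
    using B22_imp_not_midpoint[OF assms(1)] unfolding midpoint_def P_dvd_mult_iff by blast
qed

lemma B31_of_endpoint:
  assumes "\<not> P dvd x - y" "P dvd c - x"
  shows "\<exists>z. B31 x y z c"
proof -
  have "P dvd x - y" if "P dvd x - (2 * x - y)"
    using that by Groebner_Basis.algebra
  moreover have "P dvd 2 * (x - y)" if "P dvd y - (2 * x - y)"
    using that by Groebner_Basis.algebra
  moreover have "midpoint x y (2 * x - y)"
    by (simp add: midpoint_def)
  ultimately have "B31 x y (2 * x - y) c"
    using assms not_P_dvd_small(1) P_dvd_mult_iff unfolding B31_def by blast
  then show ?thesis ..
qed

lemma B31_of_midpoint:
  assumes "\<not> P dvd x - y" "midpoint c x y"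
  shows "B31 x y c c"
proof -
  have "P dvd x - y" if "P dvd y - c \<or> P dvd x - c"
    using that assms(2) unfolding midpoint_def
    by (elim disjE) (Groebner_Basis.algebra, Groebner_Basis.algebra)
  then show ?thesis
    using assms unfolding B31_def by auto
qed

lemma B22_exists:
  assumes "\<not> P dvd x - y" "\<not> P dvd c - x" "\<not> P dvd c - y" "\<not> midpoint c x y"
  shows "\<exists>d. B22 x y c d"
proof -
  obtain d where "P dvd (x + y - 2 * c) * d - (2 * x * y - (x + y) * c)"
    using exists_quotient assms(4) unfolding midpoint_def by blast
  then have conjugate: "harmonic x y c d"
    unfolding harmonic_def by Groebner_Basis.algebra
  have "P dvd 2 * ((c - x) * (c - y))" if "P dvd c - d"
    using that conjugate unfolding harmonic_def by Groebner_Basis.algebra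
  then have "\<not> P dvd c - d"
    using assms(2,3) not_P_dvd_small(1) P_dvd_mult_iff by blast
  then show ?thesis
    using conjugate assms(1) unfolding B22_def by blast
qed

lemma B31_or_B22:
  assumes "\<not> P dvd x - y"
  shows "(\<exists>z. B31 x y z c) \<or> (\<exists>d. B22 x y c d)"
proof -
  have "\<not> P dvd y - x"
    using assms by (simp add: dvd_diff_commute)
  then have "\<exists>z. B31 x y z c" if "P dvd c - x \<or> P dvd c - y \<or> midpoint c x y"
    using that assms B31_of_endpoint B31_of_midpoint B31_swap(1) by blast
  then show ?thesis
    using B22_exists[OF assms] by blast
qed

sublocale doubling p B40 B31 B22
  by unfold_locales
    (fact p_gt_4 swap12 swap23 swap34 B31_swap B22_swap B22_opposite B40_add B31_add B22_add
      B40_cong B31_cong B22_cong B40_irrefl B31_irrefl B22_irrefl B40_or_B31 B40_not_B31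
      B40_unique B31_fourth_unique B31_or_B22 B22_not_B31 B22_unique B31_third_unique)+

end

section \<open>Base blocks\<close>

definition ordered_pairs :: "'a list \<Rightarrow> ('a \<times> 'a) list" where
  "ordered_pairs xs = [(x, y). x \<leftarrow> xs, y \<leftarrow> xs, x \<noteq> y]"

(* The image of c under the affine map that sends a to 0 and b to 1. *)
definition ratio :: "int \<Rightarrow> int \<Rightarrow> int \<Rightarrow> int \<Rightarrow> int" where
  "ratio P a b c = (c - a) * modular_inverse P (b - a) mod P"

definition block_ratios :: "int \<Rightarrow> int list \<Rightarrow> (int \<times> int) list" where
  "block_ratios P B = [(ratio P a b c, ratio P a b d).
     (a, b) \<leftarrow> ordered_pairs B, (c, d) \<leftarrow> ordered_pairs [c \<leftarrow> B. c \<notin> {a, b}]]"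

definition ratio_table :: "int \<Rightarrow> int list list \<Rightarrow> (int \<times> int) list" where
  "ratio_table P Bs = concat (map (\<lambda>B. remdups (block_ratios P B)) Bs)"

definition affine_base :: "int \<Rightarrow> int list list \<Rightarrow> bool" where
  "affine_base P Bs \<longleftrightarrow> list_all (list_all (\<lambda>a. 0 \<le> a \<and> a < P)) Bs \<and>
     sort (map fst (ratio_table P Bs)) = [l \<leftarrow> [3..P - 2]. 2 * l \<noteq> P + 1]"

lemma set_ordered_pairs: "set (ordered_pairs xs) = {(x, y). x \<in> set xs \<and> y \<in> set xs \<and> x \<noteq> y}"
  by (auto simp: ordered_pairs_def)

lemma set_block_ratios:
  "set (block_ratios P B) = {(ratio P a b c, ratio P a b d) | a b c d.
     {a, b, c, d} \<subseteq> set B \<and> distinct [a, b, c, d]}"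
proof -
  have "set (block_ratios P B) = {(ratio P a b c, ratio P a b d) | a b c d.
      (a, b) \<in> set (ordered_pairs B) \<and> (c, d) \<in> set (ordered_pairs [c \<leftarrow> B. c \<notin> {a, b}])}"
    unfolding block_ratios_def by force
  then show ?thesis
    unfolding set_ordered_pairs by auto
qed

locale base_blocks = prime_modulus +
  fixes Bs :: "int list list"
  assumes p_ge_5: "5 \<le> p" and affine_base: "affine_base P Bs"
begin

definition affine_equivalent ::
    "int \<Rightarrow> int \<Rightarrow> int \<Rightarrow> int \<Rightarrow> int \<Rightarrow> int \<Rightarrow> int \<Rightarrow> int \<Rightarrow> bool" where
  "affine_equivalent a b c d x y z w \<longleftrightarrow> (\<exists>s t. \<not> P dvd s \<and>
     P dvd x - (s * a + t) \<and> P dvd y - (s * b + t) \<and> P dvd z - (s * c + t) \<and> P dvd w - (s * d + t))"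

definition affine_image :: "int \<Rightarrow> int \<Rightarrow> int \<Rightarrow> int \<Rightarrow> bool" where
  "affine_image x y z w \<longleftrightarrow> (\<exists>B\<in>set Bs. \<exists>a b c d.
     {a, b, c, d} \<subseteq> set B \<and> distinct [a, b, c, d] \<and> affine_equivalent a b c d x y z w)"

lemma base_block_distinct_mod:
  assumes "B \<in> set Bs" "{a, b} \<subseteq> set B" "a \<noteq> b"
  shows "\<not> P dvd a - b"
proof -
  have "0 \<le> a" "a < P" "0 \<le> b" "b < P"
    using affine_base assms(1,2) by (auto simp: affine_base_def list_all_iff)
  then show ?thesis
    using assms(3) by (simp flip: mod_eq_dvd_iff)
qed

lemma ratio_eq_mod_iff:
  assumes "\<not> P dvd a - b"
  shows "ratio P a b c = l mod P \<longleftrightarrow> P dvd (c - a) - l * (b - a)"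
proof -
  define k where "k = modular_inverse P (b - a)"
  have "\<not> P dvd b - a"
    using assms by (simp add: dvd_diff_commute)
  then have "coprime (b - a) P"
    using prime_p prime_imp_coprime[of P "b - a"] by (simp add: coprime_commute)
  then have inverse: "P dvd (b - a) * k - 1"
    unfolding k_def cong_iff_dvd_diff[symmetric] by (rule cong_modular_inverse1)
  have "ratio P a b c = l mod P \<longleftrightarrow> P dvd (c - a) * k - l"
    unfolding ratio_def k_def by (rule mod_eq_dvd_iff)
  also have "\<dots> \<longleftrightarrow> P dvd (c - a) - l * (b - a)"
    using inverse by (intro iffI) Groebner_Basis.algebra+
  finally show ?thesis .
qed

lemma affine_equivalent_0_1_iff:
  assumes "\<not> P dvd a - b"
  shows "affine_equivalent a b c d 0 1 l m \<longleftrightarrow>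
    P dvd (c - a) - l * (b - a) \<and> P dvd (d - a) - m * (b - a)" (is "?L \<longleftrightarrow> ?R")
proof
  assume ?L
  then obtain s t where "P dvd 0 - (s * a + t)" "P dvd 1 - (s * b + t)"
      "P dvd l - (s * c + t)" "P dvd m - (s * d + t)"
    unfolding affine_equivalent_def by blast
  then have "P dvd (c - a) - l * (b - a)" "P dvd (d - a) - m * (b - a)"
    by Groebner_Basis.algebra+
  then show ?R ..
next
  assume ?R
  obtain k where inverse: "P dvd (a - b) * k - 1"
    using exists_quotient assms by blast
  have "P dvd 1 - (- k * b + k * a)" "P dvd l - (- k * c + k * a)" "P dvd m - (- k * d + k * a)"
    using inverse conjunct1[OF \<open>?R\<close>] conjunct2[OF \<open>?R\<close>] by Groebner_Basis.algebra+
  moreover have "P dvd 1" if "P dvd - k"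
    using that inverse by Groebner_Basis.algebra
  then have "\<not> P dvd - k"
    using p_ge_5 by (auto simp: zdvd_not_zless)
  moreover have "P dvd 0 - (- k * a + k * a)"
    by simp
  ultimately show ?L
    unfolding affine_equivalent_def by blast
qed

lemma affine_image_0_1_iff:
  "affine_image 0 1 l m \<longleftrightarrow> (l mod P, m mod P) \<in> set (ratio_table P Bs)"
proof -
  have "affine_image 0 1 l m \<longleftrightarrow> (\<exists>B\<in>set Bs. \<exists>a b c d. {a, b, c, d} \<subseteq> set B \<and> distinct [a, b, c, d] \<and>
      ratio P a b c = l mod P \<and> ratio P a b d = m mod P)"
    unfolding affine_image_def
  proof (intro bex_cong refl ex_cong1 conj_cong)
    fix B a b c d
    assume "B \<in> set Bs" "{a, b, c, d} \<subseteq> set B" "distinct [a, b, c, d]"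
    then have distinct: "\<not> P dvd a - b"
      using base_block_distinct_mod[of B a b] by simp
    show "affine_equivalent a b c d 0 1 l m \<longleftrightarrow>
        ratio P a b c = l mod P \<and> ratio P a b d = m mod P"
      unfolding affine_equivalent_0_1_iff[OF distinct] ratio_eq_mod_iff[OF distinct] ..
  qed
  also have "\<dots> \<longleftrightarrow> (\<exists>B\<in>set Bs. (l mod P, m mod P) \<in> set (block_ratios P B))"
    unfolding set_block_ratios mem_Collect_eq prod.inject by (intro bex_cong refl) metis
  also have "\<dots> \<longleftrightarrow> (l mod P, m mod P) \<in> set (ratio_table P Bs)"
    by (simp add: ratio_table_def)
  finally show ?thesis .
qed

lemma sort_ratio_table: "sort (map fst (ratio_table P Bs)) = [l \<leftarrow> [3..P - 2]. 2 * l \<noteq> P + 1]"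
  using affine_base unfolding affine_base_def by blast

lemma nondegenerate_mod_iff:
  "nondegenerate l \<longleftrightarrow> 3 \<le> l mod P \<and> l mod P \<le> P - 2 \<and> 2 * (l mod P) \<noteq> P + 1"
proof -
  define r where "r = l mod P"
  have r_bounds: "0 \<le> r" "r < P" "P dvd l - r"
    using P_pos unfolding r_def by (simp_all flip: mod_eq_dvd_iff)
  have residue: "P dvd l - a \<longleftrightarrow> r = a" if "0 \<le> a" "a < P" for a
    using that unfolding r_def by (simp flip: mod_eq_dvd_iff)
  have "P dvd l + 1 \<longleftrightarrow> P dvd l - (P - 1)"
    using dvd_add_triv_right_iff[of P "l - (P - 1)"] by (simp add: algebra_simps)
  moreover have "P dvd 2 * l - 1 \<longleftrightarrow> 2 * r = P + 1"
  proof -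
    have "P dvd 2 * l - 1 \<longleftrightarrow> P dvd 2 * r - 1 - P"
      using r_bounds(3) by (intro iffI) Groebner_Basis.algebra+
    also have "\<dots> \<longleftrightarrow> 2 * r - 1 - P = 0"
    proof
      assume dvd: "P dvd 2 * r - 1 - P"
      have "r \<noteq> 0"
      proof
        assume "r = 0"
        then have "P dvd 1"
          using dvd by Groebner_Basis.algebra
        then show False
          using p_ge_5 by (simp add: zdvd_not_zless)
      qed
      then have "\<bar>2 * r - 1 - P\<bar> < \<bar>P\<bar>"
        using r_bounds(1,2) by linarith
      then show "2 * r - 1 - P = 0"
        using dvd by (metis dvd_imp_le_int not_less)
    qed simp
    finally show ?thesis
      by linarith
  qed
  ultimately show ?thesis
    using residue[of 0] residue[of 1] residue[of 2] residue[of "P - 1"] r_bounds p_ge_5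
    unfolding nondegenerate_def r_def[symmetric] by auto
qed

lemma affine_image_domain: "(\<exists>m. affine_image 0 1 l m) \<longleftrightarrow> nondegenerate l"
proof -
  have "(\<exists>m. affine_image 0 1 l m) \<longleftrightarrow> l mod P \<in> set (map fst (ratio_table P Bs))"
  proof
    assume "l mod P \<in> set (map fst (ratio_table P Bs))"
    then obtain m where "(l mod P, m) \<in> set (ratio_table P Bs)"
      by auto
    moreover from this have "m mod P = m"
      by (auto simp: ratio_table_def set_block_ratios ratio_def)
    ultimately show "\<exists>m. affine_image 0 1 l m"
      unfolding affine_image_0_1_iff by metis
  qed (force simp: affine_image_0_1_iff)
  also have "\<dots> \<longleftrightarrow> l mod P \<in> set [l \<leftarrow> [3..P - 2]. 2 * l \<noteq> P + 1]"
    unfolding sort_ratio_table[symmetric] set_sort ..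
  also have "\<dots> \<longleftrightarrow> nondegenerate l"
    unfolding nondegenerate_mod_iff by simp
  finally show ?thesis .
qed

lemma affine_image_unique:
  assumes "affine_image 0 1 l m" "affine_image 0 1 l m'"
  shows "P dvd m - m'"
proof -
  have "distinct (sort (map fst (ratio_table P Bs)))"
    unfolding sort_ratio_table by simp
  then have "m mod P = m' mod P"
    using assms unfolding affine_image_0_1_iff distinct_sort by (metis eq_key_imp_eq_value)
  then show ?thesis
    by (simp add: mod_eq_dvd_iff)
qed

lemma affine_equivalent_cong:
  assumes "affine_equivalent a b c d x y z w" "P dvd w - w'"
  shows "affine_equivalent a b c d x y z w'"
proof -
  have "P dvd w' - i" if "P dvd w - i" for i
    using that assms(2) by Groebner_Basis.algebra
  then show ?thesis
    using assms(1) unfolding affine_equivalent_def by blast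
qed

lemma affine_equivalent_affine:
  assumes "affine_equivalent a b c d x y z w" "\<not> P dvd s"
  shows "affine_equivalent a b c d (s * x + t) (s * y + t) (s * z + t) (s * w + t)"
proof -
  obtain s' t' where image: "\<not> P dvd s'" "P dvd x - (s' * a + t')" "P dvd y - (s' * b + t')"
      "P dvd z - (s' * c + t')" "P dvd w - (s' * d + t')"
    using assms(1) unfolding affine_equivalent_def by blast
  have "P dvd s * i + t - (s * s' * j + (s * t' + t))" if "P dvd i - (s' * j + t')" for i j
    using that by Groebner_Basis.algebra
  moreover have "\<not> P dvd s * s'"
    using assms(2) image(1) by (simp add: P_dvd_mult_iff)
  ultimately show ?thesis
    using image(2-5) unfolding affine_equivalent_def by blast
qed

lemma affine_equivalent_imp_distinct:
  assumes "affine_equivalent a b c d x y z w" "\<not> P dvd a - b"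
  shows "\<not> P dvd x - y"
proof
  assume same: "P dvd x - y"
  obtain s t where image: "\<not> P dvd s" "P dvd x - (s * a + t)" "P dvd y - (s * b + t)"
    using assms unfolding affine_equivalent_def by blast
  have "P dvd s * (a - b)"
    using same image(2,3) by Groebner_Basis.algebra
  then show False
    using assms(2) image(1) by (simp add: P_dvd_mult_iff)
qed

lemma affine_equivalent_swap:
  "affine_equivalent a b c d x y z w \<Longrightarrow> affine_equivalent b a c d y x z w"
  "affine_equivalent a b c d x y z w \<Longrightarrow> affine_equivalent a c b d x z y w"
  "affine_equivalent a b c d x y z w \<Longrightarrow> affine_equivalent a b d c x y w z"
  unfolding affine_equivalent_def by blast+

lemma affine_image_E:
  assumes "affine_image x y z w"
  obtains B a b c d where "B \<in> set Bs" "{a, b, c, d} \<subseteq> set B" "distinct [a, b, c, d]"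
    "affine_equivalent a b c d x y z w"
  using assms unfolding affine_image_def by blast

lemma affine_image_I:
  "B \<in> set Bs \<Longrightarrow> {a, b, c, d} \<subseteq> set B \<Longrightarrow> distinct [a, b, c, d] \<Longrightarrow>
    affine_equivalent a b c d x y z w \<Longrightarrow> affine_image x y z w"
  unfolding affine_image_def by blast

lemma affine_image_cong: "affine_image x y z w \<Longrightarrow> P dvd w - w' \<Longrightarrow> affine_image x y z w'"
  by (erule affine_image_E, rule affine_image_I, assumption+, erule (1) affine_equivalent_cong)

lemma affine_image_affine:
  "affine_image x y z w \<Longrightarrow> \<not> P dvd s \<Longrightarrow>
    affine_image (s * x + t) (s * y + t) (s * z + t) (s * w + t)"
  by (erule affine_image_E, rule affine_image_I, assumption+, erule (1) affine_equivalent_affine)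

lemma affine_image_irrefl:
  assumes "affine_image x y z w"
  shows "\<not> P dvd x - y"
proof -
  obtain B a b c d where block: "B \<in> set Bs" "{a, b, c, d} \<subseteq> set B" "distinct [a, b, c, d]"
      and image: "affine_equivalent a b c d x y z w"
    by (rule affine_image_E[OF assms])
  then have "\<not> P dvd a - b"
    using base_block_distinct_mod[of B a b] by simp
  then show ?thesis
    by (rule affine_equivalent_imp_distinct[OF image])
qed

lemma affine_image_swap:
  assumes "affine_image x y z w"
  shows "affine_image y x z w" "affine_image x z y w" "affine_image x y w z"
proof -
  obtain B a b c d where block: "B \<in> set Bs" "{a, b, c, d} \<subseteq> set B" "distinct [a, b, c, d]"
      and image: "affine_equivalent a b c d x y z w"
    by (rule affine_image_E[OF assms])
  show "affine_image y x z w"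
    by (rule affine_image_I[OF block(1) _ _ affine_equivalent_swap(1)[OF image]])
      (use block(2,3) in auto)
  show "affine_image x z y w"
    by (rule affine_image_I[OF block(1) _ _ affine_equivalent_swap(2)[OF image]])
      (use block(2,3) in auto)
  show "affine_image x y w z"
    by (rule affine_image_I[OF block(1) _ _ affine_equivalent_swap(3)[OF image]])
      (use block(2,3) in auto)
qed

sublocale affine_construction p affine_image
  by unfold_locales
    (fact affine_image_swap p_ge_5 affine_image_cong affine_image_affine affine_image_irrefl
      affine_image_domain affine_image_unique)+

end

lemma strictly_cyclic_SQS_of_affine_base:
  assumes "prime p" "5 \<le> p" "affine_base (int p) Bs"
  shows "\<exists>S. strictly_cyclic_SQS 2 p S"
proof -
  interpret base_blocks p Bs
    using assms by unfold_locales
  show ?thesis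
    using strictly_cyclic_blocks by blast
qed

section \<open>The eight exceptional primes\<close>

(* {0, 1, e, f} with f = (1 + e) / 3 is an equilateral triangle with its centre.  The parameters of
   the blocks {0, 1, a, 1 - a} are a perfect matching of the cubic graph that they define on the
   remaining affine classes of triples. *)
definition symmetric_base :: "int \<Rightarrow> int \<Rightarrow> int \<Rightarrow> int list \<Rightarrow> int list list" where
  "symmetric_base P e f as = [0, 1, e, f] # map (\<lambda>a. [0, 1, a, P + 1 - a]) as"

lemma affine_base_37: "affine_base 37 (symmetric_base 37 11 4 [3, 7])"
  by code_simp

lemma affine_base_61: "affine_base 61 (symmetric_base 61 14 5 [3, 4, 12, 26])"
  by code_simp

lemma affine_base_73: "affine_base 73 (symmetric_base 73 9 52 [5, 6, 7, 19, 26])"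
  by code_simp

lemma affine_base_109: "affine_base 109 (symmetric_base 109 46 52 [3, 6, 11, 18, 21, 22, 29, 30])"
  by code_simp

lemma affine_base_157:
  "affine_base 157
     (symmetric_base 157 13 57 [7, 8, 15, 22, 27, 28, 34, 40, 43, 48, 51, 54])"
  by code_simp

lemma affine_base_181:
  "affine_base 181
     (symmetric_base 181 49 77 [3, 4, 5, 6, 7, 8, 9, 14, 20, 43, 57, 74, 76, 82])"
  by code_simp

lemma affine_base_229:
  "affine_base 229
     (symmetric_base 229 95 32
       [5, 6, 7, 8, 11, 12, 19, 22, 23, 29, 30, 41, 42, 43, 44, 58, 70, 93])"
  by code_simp

lemma affine_base_277:
  "affine_base 277
     (symmetric_base 277 117 224
       [3, 4, 5, 10, 15, 18, 23, 24, 31, 32, 33, 38, 39, 43, 44, 45, 49, 63, 78, 79, 80, 89])"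
  by code_simp

lemma strictly_cyclic_SQS_exceptional:
  assumes "p \<in> {37, 61, 73, 109, 157, 181, 229, 277 :: nat}"
  shows "\<exists>S. strictly_cyclic_SQS 2 p S"
proof -
  have "prime p" "5 \<le> p"
    using assms by auto
  moreover have "\<exists>Bs. affine_base (int p) Bs"
    using assms affine_base_37 affine_base_61 affine_base_73 affine_base_109 affine_base_157
      affine_base_181 affine_base_229 affine_base_277 by auto
  ultimately show ?thesis
    using strictly_cyclic_SQS_of_affine_base by blast
qed

theorem theorem4p5:
  fixes p :: nat
  assumes "(prime p \<and> p mod 12 = 7) \<or> p \<in> {37, 61, 73, 109, 157, 181, 229, 277}"
  shows "(\<exists>S. strictly_cyclic_SQS 2 p S) \<and> (\<exists>C. perfect_OOC2D 2 p C)"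
proof -
  have "0 < p"
    using assms by (auto intro: prime_gt_0_nat)
  obtain S where system: "strictly_cyclic_SQS 2 p S"
    using assms strictly_cyclic_SQS_7_mod_12 strictly_cyclic_SQS_exceptional by blast
  then interpret strictly_cyclic_quadruple_system 2 p S
    using \<open>0 < p\<close> by unfold_locales
  show ?thesis
    using system perfect_OOC2D_exists by blast
qed

end
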